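(* Let $k\ge2$, $0\le r\le k$ and $s\ge1$ be integers. In the space $\mathcal H^{(s)}_{k,r}$ (defined in the context), the set of normal-ordered monomials, i.e. the set of vectors of the form $$\varphi_{a_1,n_1}\cdots\varphi_{a_s,n_s}$$ with $0\le a_j\le k$, $n_j\in\mathbb Z$, such that $$\min(a_j,k-a_{j+1})-n_j+n_{j+1}\ge k\quad\text{for all }1\le j\le s-1,\qquad n_s\le\min(a_s-r,0),$$ is linearly independent.
   Context: $W$ is the $(k+1)$-dimensional irreducible $sl_2$-module with basis $\varphi_0,\dots,\varphi_k$ and $E\varphi_a=(k-a+1)\varphi_{a-1}$, $H\varphi_a=(k-2a)\varphi_a$, $F\varphi_a=(a+1)\varphi_{a+1}$ (with $\varphi_{-1}=\varphi_{k+1}=0$). $B_k$ is the unital associative $\mathbb C$-algebra generated by $\varphi_{a,n}$ ($0\le a\le k$, $n\in\mathbb Z$) subject only to $\varphi_{a,m}\varphi_{b,n}=(-1)^k\varphi_{b,n}\varphi_{a,m}$. $B_k^{(s)}$ is the span of products of $s$ generators. For $N\in\mathbb Z$, $B_{k,N}$ is the ideal generated by $\{\varphi_{a,m}: m>N\}$, $B^{(s)}_{k,N}=B_k^{(s)}\cap B_{k,N}$, and $\bar B_k=\bigoplus_{s\ge0}\bar B_k^{(s)}$ with $\bar B_k^{(s)}=\varprojlim_N B_k^{(s)}/B_{k,N}^{(s)}$. Put $\varphi_a(z)=\sum_n\varphi_{a,n}z^{-n}$ and let $\varphi_a^{(m)}(z)$ be its $m$-th derivative. The Lie algebra $\widehat{sl}_2=sl_2\otimes\mathbb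 C[t,t^{-1}]\oplus\mathbb Cc\oplus\mathbb Cd$ acts on $B_k$ and $\bar B_k$ by derivations with $(X\otimes t^i)\varphi_a(z)=z^i(X\varphi_a)(z)$, $c=0$, $d\,\varphi_{a,n}=n\varphi_{a,n}$. $Q_k^{(2)}\subset\bar B_k^{(2)}$ is the $\widehat{sl}_2$-invariant subspace generated by the Fourier coefficients of $\varphi_0(z)\varphi_0^{(k-2)}(z)$. $N^{(s)}_{k,r}\subset B_k^{(s)}$ is the span of the subspaces $B_k^{(s-1)}\varphi_{a,n}$ with $0\le a\le k$ and $n>\min(a-r,0)$. It contains $B^{(s)}_{k,0}$, so there is a natural map $\bar B_k^{(s)}\to B_k^{(s)}/N^{(s)}_{k,r}$. $\mathcal H^{(s)}_{k,r}$ is the quotient of $B_k^{(s)}/N^{(s)}_{k,r}$ by the quadratic relations, i.e. by the image of $\bar B_k^{(s-2)}\cdot Q_k^{(2)}$ (zero if $s=1$). *)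

theory Defs
  imports
    Complex_Main
    "HOL-Library.Poly_Mapping"
    "HOL-Library.Set_Algebras"
    "HOL-Library.Cardinality"
begin

section \<open>The free algebra on letters \<open>\<phi>\<^sub>a\<^sub>,\<^sub>n\<close>\<close>

datatype word = Word (letters: "(nat \<times> int) list")

instantiation word :: monoid_add
begin
definition "0 = Word []"
definition "u + v = Word (letters u @ letters v)"
instance
  by standard (simp_all add: zero_word_def plus_word_def)
end

text \<open>The monoid algebra of the free monoid; multiplication is convolution.\<close>

type_synonym falg = "word \<Rightarrow>\<^sub>0 complex"

definition fconst :: "complex \<Rightarrow> falg"
  where "fconst c = Poly_Mapping.single 0 c"

definition fword :: "(nat \<times> int) list \<Rightarrow> falg"
  where "fword xs = Poly_Mapping.single (Word xs) 1"

definition fgen :: "nat \<Rightarrow> int \<Rightarrow> falg"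
  where "fgen a n = fword [(a, n)]"

inductive_set two_sided_ideal :: "'a::ring_1 set \<Rightarrow> 'a set" for S
  where
    zero: "0 \<in> two_sided_ideal S"
  | gen: "x \<in> S \<Longrightarrow> u * x * v \<in> two_sided_ideal S"
  | add: "x \<in> two_sided_ideal S \<Longrightarrow> y \<in> two_sided_ideal S \<Longrightarrow> x + y \<in> two_sided_ideal S"

text \<open>The free algebra has letters for all natural numbers \<open>a\<close>; the second family of relators
  removes those with \<open>a > k\<close>, so that the quotient is generated by the \<open>\<phi>\<^sub>a\<^sub>,\<^sub>n\<close> with \<open>a \<le> k\<close>,
  and \<open>\<phi>\<^sub>k\<^sub>+\<^sub>1 = 0\<close>.\<close>

definition relators :: "nat \<Rightarrow> falg set"
  where "relators k =
    {fgen a m * fgen b n - (- 1) ^ k * (fgen b n * fgen a m) | a b m n. a \<le> k \<and> b \<le> k}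
    \<union> {fgen a n | a n. k < a}"

lemma fconst_simps:
  "fconst 0 = 0" "fconst 1 = 1" "fconst (c + d) = fconst c + fconst d"
  "fconst (c * d) = fconst c * fconst d" "fconst (- c) = - fconst c"
  by (simp_all add: fconst_def single_add mult_single single_uminus)

lemma fword_append: "fword (xs @ ys) = fword xs * fword ys"
  by (simp add: fword_def mult_single plus_word_def)

lemma fword_Nil: "fword [] = 1"
  by (simp add: fword_def zero_word_def[symmetric])

lemma falg_expand: "p = (\<Sum>w\<in>Poly_Mapping.keys p. fconst (Poly_Mapping.lookup p w) * fword (letters w))"
proof -
  have "Poly_Mapping.lookup (\<Sum>w\<in>Poly_Mapping.keys p. Poly_Mapping.single w (Poly_Mapping.lookup p w)) v
      = Poly_Mapping.lookup p v" for v
    by (simp add: lookup_sum lookup_single when_def in_keys_iff)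
  then have "p = (\<Sum>w\<in>Poly_Mapping.keys p. Poly_Mapping.single w (Poly_Mapping.lookup p w))"
    by (metis poly_mapping_eqI)
  then show ?thesis
    by (simp add: fconst_def fword_def mult_single)
qed

lemma falg_induct [case_names zero mono add]:
  assumes "P 0" "\<And>c xs. P (fconst c * fword xs)" "\<And>p q. P p \<Longrightarrow> P q \<Longrightarrow> P (p + q)"
  shows "P p"
proof -
  have "P (\<Sum>w\<in>A. fconst (Poly_Mapping.lookup p w) * fword (letters w))" if "finite A" for A
    using that by (induction A rule: finite_induct) (simp_all add: assms)
  then show ?thesis
    by (subst falg_expand) simp
qed

lemma fconst_central: "fconst c * p = p * fconst c"
proof (induction p rule: falg_induct)
  case (mono d xs)
  show ?case
    by (simp add: fconst_def fword_def mult_single mult.commute)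
qed (simp_all add: algebra_simps)

lemma fconst_central_left: "p * (fconst c * q) = fconst c * (p * q)"
  by (metis fconst_central mult.assoc)

lemma ideal_mult_left: "x \<in> two_sided_ideal S \<Longrightarrow> u * x \<in> two_sided_ideal S"
proof (induction rule: two_sided_ideal.induct)
  case (gen x u' v)
  then show ?case
    using two_sided_ideal.gen[of x S "u * u'" v] by (simp add: mult.assoc)
qed (simp_all add: distrib_left two_sided_ideal.intros)

lemma ideal_mult_right: "x \<in> two_sided_ideal S \<Longrightarrow> x * u \<in> two_sided_ideal S"
proof (induction rule: two_sided_ideal.induct)
  case (gen x u' v)
  then show ?case
    using two_sided_ideal.gen[of x S "u'" "v * u"] by (simp add: mult.assoc)
qed (simp_all add: distrib_right two_sided_ideal.intros)

lemma ideal_uminus: "x \<in> two_sided_ideal S \<Longrightarrow> - x \<in> two_sided_ideal S"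
  using ideal_mult_left[of x S "- 1"] by simp

lemma ideal_diff: "x \<in> two_sided_ideal S \<Longrightarrow> y \<in> two_sided_ideal S \<Longrightarrow> x - y \<in> two_sided_ideal S"
  using two_sided_ideal.add[of x S "- y"] ideal_uminus[of y S] by simp

lemma ideal_base: "x \<in> S \<Longrightarrow> x \<in> two_sided_ideal S"
  using two_sided_ideal.gen[of x S 1 1] by simp

lemma ideal_relator:
  "fgen a m * fgen b n - (- 1) ^ k * (fgen b n * fgen a m) \<in> two_sided_ideal (relators k)"
proof (cases "a \<le> k \<and> b \<le> k")
  case True
  then show ?thesis
    by (intro ideal_base) (auto simp: relators_def)
next
  case False
  then have "fgen a m \<in> relators k \<or> fgen b n \<in> relators k"
    by (auto simp: relators_def)
  then show ?thesis
    by (meson ideal_base ideal_diff ideal_mult_left ideal_mult_right)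
qed

lemma lookup_fconst_mult: "Poly_Mapping.lookup (fconst c * p) w = c * Poly_Mapping.lookup p w"
  by (simp add: fconst_def flip: mult_map_scale_conv_mult) (simp add: map.rep_eq when_def)

lemma lookup_empty_mult:
  "Poly_Mapping.lookup (p * q) (0 :: word) = Poly_Mapping.lookup p 0 * Poly_Mapping.lookup (q :: falg) 0"
proof (induction p rule: falg_induct)
  case (mono c xs)
  have "Poly_Mapping.lookup (fword xs * q) 0 = Poly_Mapping.lookup (fword xs) 0 * Poly_Mapping.lookup q 0"
  proof (induction q rule: falg_induct)
    case (mono d ys)
    have "fword xs * (fconst d * fword ys) = fconst d * fword (xs @ ys)"
      by (simp add: fconst_central_left fword_append)
    then show ?case
      by (simp add: lookup_fconst_mult) (simp add: fword_def lookup_single when_def zero_word_def)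
  qed (simp_all add: algebra_simps lookup_add)
  then show ?case
    by (simp add: mult.assoc lookup_fconst_mult)
qed (simp_all add: algebra_simps lookup_add)

lemma lookup_empty_fgen: "Poly_Mapping.lookup (fgen a n) 0 = 0"
  by (simp add: fgen_def fword_def lookup_single when_def zero_word_def)

lemma one_notin_ideal: "1 \<notin> two_sided_ideal (relators k)"
proof -
  have "Poly_Mapping.lookup p 0 = 0" if "p \<in> two_sided_ideal (relators k)" for p :: falg
    using that
  proof (induction rule: two_sided_ideal.induct)
    case (gen x u v)
    then have "Poly_Mapping.lookup x 0 = 0"
      by (auto simp: relators_def lookup_empty_fgen lookup_minus lookup_empty_mult)
    then show ?case
      by (simp add: lookup_empty_mult)
  qed (simp_all add: lookup_add)
  then show ?thesis
    by (metis lookup_one_zero zero_neq_one)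
qed


section \<open>The algebra \<open>B\<^sub>k\<close>\<close>

text \<open>The integer \<open>k\<close> is carried by the type argument: \<open>'k bk\<close> is \<open>B\<^sub>k\<close> for \<open>k = CARD('k)\<close>.\<close>

quotient_type 'k bk = falg / "\<lambda>p q. p - q \<in> two_sided_ideal (relators CARD('k))"
proof (rule equivpI)
  show "reflp (\<lambda>p q. p - q \<in> two_sided_ideal (relators CARD('k)))"
    by (simp add: reflp_def two_sided_ideal.zero)
  show "symp (\<lambda>p q. p - q \<in> two_sided_ideal (relators CARD('k)))"
    by (auto simp: symp_def dest: ideal_uminus)
  show "transp (\<lambda>p q. p - q \<in> two_sided_ideal (relators CARD('k)))"
    by (auto simp: transp_def dest: two_sided_ideal.add)
qed

instantiation bk :: (type) ring_1
begin

lift_definition zero_bk :: "'a bk" is 0 .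
lift_definition one_bk :: "'a bk" is 1 .
lift_definition plus_bk :: "'a bk \<Rightarrow> 'a bk \<Rightarrow> 'a bk" is "(+)"
  by (metis add_diff_add two_sided_ideal.add)
lift_definition uminus_bk :: "'a bk \<Rightarrow> 'a bk" is uminus
  by (metis ideal_uminus minus_diff_minus)
lift_definition minus_bk :: "'a bk \<Rightarrow> 'a bk \<Rightarrow> 'a bk" is "(-)"
proof -
  fix p p' q q' :: falg
  assume "p - p' \<in> two_sided_ideal (relators CARD('a))"
    and "q - q' \<in> two_sided_ideal (relators CARD('a))"
  then have "(p - p') - (q - q') \<in> two_sided_ideal (relators CARD('a))"
    by (rule ideal_diff)
  then show "p - q - (p' - q') \<in> two_sided_ideal (relators CARD('a))"
    by (simp add: algebra_simps)
qed
lift_definition times_bk :: "'a bk \<Rightarrow> 'a bk \<Rightarrow> 'a bk" is "(*)"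
proof -
  fix p p' q q' :: falg
  assume "p - p' \<in> two_sided_ideal (relators CARD('a))"
    and "q - q' \<in> two_sided_ideal (relators CARD('a))"
  then have "(p - p') * q + p' * (q - q') \<in> two_sided_ideal (relators CARD('a))"
    by (intro two_sided_ideal.add ideal_mult_left ideal_mult_right)
  then show "p * q - p' * q' \<in> two_sided_ideal (relators CARD('a))"
    by (simp add: algebra_simps)
qed

instance
proof
  show "(0 :: 'a bk) \<noteq> 1"
    by transfer (use one_notin_ideal ideal_uminus in fastforce)
qed (transfer; simp add: algebra_simps two_sided_ideal.zero)+

end

lift_definition phi :: "nat \<Rightarrow> int \<Rightarrow> 'k bk" is fgen .

lift_definition bscale :: "complex \<Rightarrow> 'k bk \<Rightarrow> 'k bk" is "\<lambda>c p. fconst c * p"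
  by (metis ideal_mult_left right_diff_distrib)

interpretation bk: vector_space bscale
  by standard (transfer; simp add: algebra_simps fconst_simps two_sided_ideal.zero)+

lemma bscale_mult: "bscale c x * y = bscale c (x * y)" "x * bscale c y = bscale c (x * y)"
  by (transfer; simp add: mult.assoc fconst_central_left two_sided_ideal.zero)+

lemma phi_commute:
  "(phi a m :: 'k bk) * phi b n = bscale ((- 1) ^ CARD('k)) (phi b n * phi a m)"
proof transfer
  fix a b m n
  have "fconst ((- 1) ^ j) = (- 1) ^ j" for j
    by (induction j) (simp_all add: fconst_simps)
  then show "fgen a m * fgen b n - fconst ((- 1) ^ CARD('k)) * (fgen b n * fgen a m)
      \<in> two_sided_ideal (relators CARD('k))"
    using ideal_relator by simp
qed

lemma phi_eq_0: "CARD('k) < a \<Longrightarrow> (phi a n :: 'k bk) = 0"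
  by transfer (auto simp: relators_def intro: ideal_base)


section \<open>The action of the affine Lie algebra\<close>

datatype sl2_basis = sl2_E | sl2_H | sl2_F

text \<open>A basis of the affine algebra: \<open>Loop X i\<close> is \<open>X \<otimes> t\<^sup>i\<close>. Invariance of a subspace
  under the algebra is invariance under these basis elements.\<close>

datatype affine_basis = Loop sl2_basis int | Central | Degree

text \<open>Comparing coefficients of \<open>z\<close> in \<open>(X \<otimes> t\<^sup>i) \<phi>\<^sub>a(z) = z\<^sup>i (X \<phi>\<^sub>a)(z)\<close> with
  \<open>\<phi>\<^sub>a(z) = \<Sum>\<^sub>n \<phi>\<^sub>a\<^sub>,\<^sub>n z\<close> to the power \<open>-n\<close>, the loop element shifts \<open>n\<close> to \<open>n + i\<close>.\<close>

fun fgen_act :: "nat \<Rightarrow> affine_basis \<Rightarrow> nat \<Rightarrow> int \<Rightarrow> falg"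
  where
    "fgen_act k (Loop sl2_E i) a n =
      (if a = 0 then 0 else fconst (of_nat k - of_nat a + 1) * fgen (a - 1) (n + i))"
  | "fgen_act k (Loop sl2_H i) a n = fconst (of_nat k - 2 * of_nat a) * fgen a (n + i)"
  | "fgen_act k (Loop sl2_F i) a n = fconst (of_nat a + 1) * fgen (a + 1) (n + i)"
  | "fgen_act k Central a n = 0"
  | "fgen_act k Degree a n = fconst (of_int n) * fgen a n"

fun fword_act :: "nat \<Rightarrow> affine_basis \<Rightarrow> (nat \<times> int) list \<Rightarrow> falg"
  where
    "fword_act k X [] = 0"
  | "fword_act k X ((a, n) # xs) = fgen_act k X a n * fword xs + fgen a n * fword_act k X xs"

definition falg_act :: "nat \<Rightarrow> affine_basis \<Rightarrow> falg \<Rightarrow> falg"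
  where "falg_act k X p =
    (\<Sum>w\<in>Poly_Mapping.keys p. fconst (Poly_Mapping.lookup p w) * fword_act k X (letters w))"

lemma falg_act_superset:
  assumes "finite A" "Poly_Mapping.keys p \<subseteq> A"
  shows "falg_act k X p = (\<Sum>w\<in>A. fconst (Poly_Mapping.lookup p w) * fword_act k X (letters w))"
  unfolding falg_act_def
  by (rule sum.mono_neutral_left) (use assms in \<open>auto simp: in_keys_iff fconst_simps\<close>)

lemma falg_act_add: "falg_act k X (p + q) = falg_act k X p + falg_act k X q"
proof -
  let ?A = "Poly_Mapping.keys p \<union> Poly_Mapping.keys q"
  have "Poly_Mapping.keys (p + q) \<subseteq> ?A"
    by (rule keys_add)
  then show ?thesis
    by (simp add: falg_act_superset[where A = ?A] lookup_add fconst_simps distrib_right sum.distrib)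
qed

lemma falg_act_scale: "falg_act k X (fconst c * p) = fconst c * falg_act k X p"
proof -
  have "Poly_Mapping.keys (fconst c * p) \<subseteq> Poly_Mapping.keys p"
    by (auto simp: in_keys_iff lookup_fconst_mult)
  then show ?thesis
    by (simp add: falg_act_superset[where A = "Poly_Mapping.keys p"] lookup_fconst_mult
        fconst_simps sum_distrib_left mult.assoc)
qed

lemma falg_act_zero: "falg_act k X 0 = 0"
  by (simp add: falg_act_def)

lemma falg_act_fword: "falg_act k X (fword xs) = fword_act k X xs"
  by (simp add: falg_act_def fword_def fconst_simps)

lemma falg_act_fgen: "falg_act k X (fgen a n) = fgen_act k X a n"
  by (simp add: fgen_def falg_act_fword fword_Nil)

lemma fword_act_append:
  "fword_act k X (xs @ ys) = fword_act k X xs * fword ys + fword xs * fword_act k X ys"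
proof (induction xs)
  case (Cons x xs)
  obtain a n where x: "x = (a, n)"
    by (cases x)
  have "fword (x # xs) = fgen a n * fword xs"
    using fword_append[of "[x]" xs] by (simp add: x fgen_def)
  then show ?case
    using Cons by (simp add: x fword_append algebra_simps)
qed (simp add: fword_Nil)

lemma falg_act_mult: "falg_act k X (p * q) = falg_act k X p * q + p * falg_act k X q"
proof (induction p rule: falg_induct)
  case (mono c xs)
  have "falg_act k X (fword xs * q) = falg_act k X (fword xs) * q + fword xs * falg_act k X q"
  proof (induction q rule: falg_induct)
    case (mono d ys)
    show ?case
      by (simp add: fconst_central_left falg_act_scale distrib_left flip: fword_append)
        (simp add: falg_act_fword fword_act_append distrib_left)
  qed (simp_all add: falg_act_add falg_act_zero distrib_left)
  then show ?case
    by (simp add: mult.assoc falg_act_scale distrib_left)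
qed (simp_all add: falg_act_add falg_act_zero distrib_right)

lemma falg_act_relator:
  assumes "x \<in> relators k"
  shows "falg_act k X x \<in> two_sided_ideal (relators k)"
proof -
  let ?I = "two_sided_ideal (relators k)"
  have sign: "falg_act k X ((- 1) ^ k * p) = (- 1) ^ k * falg_act k X p" for p
    using falg_act_scale[of k X "- 1" p] by (cases "even k") (simp_all add: fconst_simps)
  have comm: "fgen_act k X a m * fgen b n - (- 1) ^ k * (fgen b n * fgen_act k X a m) \<in> ?I"
    "fgen b n * fgen_act k X a m - (- 1) ^ k * (fgen_act k X a m * fgen b n) \<in> ?I" for a b m n
  proof -
    obtain c a' m' where act: "fgen_act k X a m = fconst c * fgen a' m'"
      by (cases "(k, X, a, m)" rule: fgen_act.cases) (auto, metis fconst_simps(1) mult_zero_left,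
          metis fconst_simps(1) mult_zero_left)
    have sc: "(- 1) ^ k * (fconst c * p) = fconst c * ((- 1) ^ k * p)" for p
      by (cases "even k") simp_all
    have "fgen_act k X a m * fgen b n - (- 1) ^ k * (fgen b n * fgen_act k X a m)
        = fconst c * (fgen a' m' * fgen b n - (- 1) ^ k * (fgen b n * fgen a' m'))"
      by (simp add: act fconst_central_left mult.assoc sc right_diff_distrib)
    moreover have "fgen b n * fgen_act k X a m - (- 1) ^ k * (fgen_act k X a m * fgen b n)
        = fconst c * (fgen b n * fgen a' m' - (- 1) ^ k * (fgen a' m' * fgen b n))"
      by (simp add: act fconst_central_left mult.assoc sc right_diff_distrib)
    ultimately show
      "fgen_act k X a m * fgen b n - (- 1) ^ k * (fgen b n * fgen_act k X a m) \<in> ?I"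
      "fgen b n * fgen_act k X a m - (- 1) ^ k * (fgen_act k X a m * fgen b n) \<in> ?I"
      by (simp_all add: ideal_mult_left ideal_relator)
  qed
  have diff: "falg_act k X (p - q) = falg_act k X p - falg_act k X q" for p q
    using falg_act_add[of k X "p - q" q] by simp
  from assms consider
      (rel) a b m n where "x = fgen a m * fgen b n - (- 1) ^ k * (fgen b n * fgen a m)"
    | (kill) a n where "x = fgen a n" "k < a"
    unfolding relators_def by blast
  then show ?thesis
  proof cases
    case rel
    have "falg_act k X x =
      (fgen_act k X a m * fgen b n - (- 1) ^ k * (fgen b n * fgen_act k X a m))
      + (fgen a m * fgen_act k X b n - (- 1) ^ k * (fgen_act k X b n * fgen a m))"
      by (simp only: rel diff sign) (simp add: falg_act_mult falg_act_fgen algebra_simps)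
    then show ?thesis
      by (simp add: comm two_sided_ideal.add)
  next
    case kill
    then have "fgen (a + 1) j \<in> ?I" "fgen a j \<in> ?I" for j
      by (auto intro!: ideal_base simp: relators_def)
    moreover have "fconst (of_nat k - of_nat a + 1) * fgen (a - 1) j \<in> ?I" for j
    proof (cases "a = k + 1")
      case False
      with kill show ?thesis
        by (intro ideal_mult_left ideal_base) (auto simp: relators_def)
    qed (simp add: fconst_simps two_sided_ideal.zero)
    ultimately have "fgen_act k X a n \<in> ?I"
      by (cases "(k, X, a, n)" rule: fgen_act.cases)
        (simp_all add: ideal_mult_left two_sided_ideal.zero del: One_nat_def)
    then show ?thesis
      by (simp add: kill(1) falg_act_fgen)
  qed
qed

lemma falg_act_ideal:
  "x \<in> two_sided_ideal (relators k) \<Longrightarrow> falg_act k X x \<in> two_sided_ideal (relators k)"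
proof (induction rule: two_sided_ideal.induct)
  case (gen x u v)
  then show ?case
    by (simp add: falg_act_mult two_sided_ideal.add ideal_mult_left ideal_mult_right
        falg_act_relator ideal_base)
qed (simp_all add: falg_act_add falg_act_zero two_sided_ideal.intros)

lift_definition act :: "affine_basis \<Rightarrow> 'k bk \<Rightarrow> 'k bk" is "falg_act CARD('k)"
proof -
  fix X :: affine_basis and p q :: falg
  assume "p - q \<in> two_sided_ideal (relators CARD('k))"
  moreover have "falg_act CARD('k) X p - falg_act CARD('k) X q = falg_act CARD('k) X (p - q)"
    using falg_act_add[of "CARD('k)" X "p - q" q] by simp
  ultimately show "falg_act CARD('k) X p - falg_act CARD('k) X q
      \<in> two_sided_ideal (relators CARD('k))"
    by (simp add: falg_act_ideal)
qed

lemma act_linear: "act X (x + y) = act X x + act X y" "act X (bscale c x) = bscale c (act X x)"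
  by (transfer; simp add: falg_act_add falg_act_scale two_sided_ideal.zero)+

lemma act_derivation: "act X (x * y) = act X x * y + x * act X y"
  by transfer (simp add: falg_act_mult two_sided_ideal.zero)

lemma act_phi:
  "act (Loop sl2_E i) (phi a n :: 'k bk) =
    (if a = 0 then 0 else bscale (of_nat CARD('k) - of_nat a + 1) (phi (a - 1) (n + i)))"
  "act (Loop sl2_H i) (phi a n :: 'k bk) = bscale (of_nat CARD('k) - 2 * of_nat a) (phi a (n + i))"
  "act (Loop sl2_F i) (phi a n :: 'k bk) = bscale (of_nat a + 1) (phi (a + 1) (n + i))"
  "act Central (phi a n :: 'k bk) = 0"
  "act Degree (phi a n :: 'k bk) = bscale (of_int n) (phi a n)"
  by (transfer; simp add: falg_act_fgen two_sided_ideal.zero)+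


section \<open>Grading and completion\<close>

definition monomial :: "(nat \<times> int) list \<Rightarrow> 'k bk"
  where "monomial w = prod_list (map (\<lambda>(a, n). phi a n) w)"

definition bgr :: "nat \<Rightarrow> 'k bk set"
  where "bgr s = bk.span {monomial w | w. length w = s \<and> (\<forall>(a, n)\<in>set w. a \<le> CARD('k))}"

definition bideal :: "int \<Rightarrow> 'k bk set"
  where "bideal N = two_sided_ideal {phi a m | a m. a \<le> CARD('k) \<and> N < m}"

definition bgr_ideal :: "nat \<Rightarrow> int \<Rightarrow> 'k bk set"
  where "bgr_ideal s N = bgr s \<inter> bideal N"

text \<open>Elements of a quotient \<open>V / U\<close> are the cosets \<open>x +o U\<close>. An element of the inverse limit is a
  compatible family of cosets; the projection from level \<open>N\<close> to level \<open>M \<le> N\<close> sends a coset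
  to the coset containing it.\<close>

definition bbar :: "nat \<Rightarrow> (int \<Rightarrow> 'k bk set) set"
  where "bbar s = {x. (\<forall>N. \<exists>u\<in>bgr s. x N = u +o bgr_ideal s N) \<and> (\<forall>M N. M \<le> N \<longrightarrow> x N \<subseteq> x M)}"

text \<open>The operations of the completion, computed on representatives. All sums and products of
  sets are elementwise, and the final summand turns the result into a full coset; \<open>s\<close> is the
  degree of the result.\<close>

definition bbar_zero :: "nat \<Rightarrow> int \<Rightarrow> 'k bk set"
  where "bbar_zero s = (\<lambda>N. bgr_ideal s N)"

definition bbar_add :: "(int \<Rightarrow> 'k bk set) \<Rightarrow> (int \<Rightarrow> 'k bk set) \<Rightarrow> int \<Rightarrow> 'k bk set"
  where "bbar_add x y = (\<lambda>N. x N + y N)"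

definition bbar_scale :: "nat \<Rightarrow> complex \<Rightarrow> (int \<Rightarrow> 'k bk set) \<Rightarrow> int \<Rightarrow> 'k bk set"
  where "bbar_scale s c x = (\<lambda>N. bscale c ` x N + bgr_ideal s N)"

definition bbar_mult :: "nat \<Rightarrow> (int \<Rightarrow> 'k bk set) \<Rightarrow> (int \<Rightarrow> 'k bk set) \<Rightarrow> int \<Rightarrow> 'k bk set"
  where "bbar_mult s x y = (\<lambda>N. x N * y N + bgr_ideal s N)"

text \<open>\<open>X \<otimes> t\<^sup>i\<close> maps level \<open>N + |i|\<close> of the filtration into level \<open>N\<close>, so the continuous
  extension of the action needs representatives of a deeper level.\<close>

fun shift :: "affine_basis \<Rightarrow> int"
  where
    "shift (Loop X i) = \<bar>i\<bar>"
  | "shift Central = 0"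
  | "shift Degree = 0"

definition bbar_act :: "nat \<Rightarrow> affine_basis \<Rightarrow> (int \<Rightarrow> 'k bk set) \<Rightarrow> int \<Rightarrow> 'k bk set"
  where "bbar_act s X x = (\<lambda>N. act X ` x (N + shift X) + bgr_ideal s N)"


section \<open>Quadratic relations\<close>

text \<open>\<open>dphi m a e\<close> is the coefficient of the \<open>e\<close>-th power of \<open>z\<close> in the \<open>m\<close>-th derivative
  of \<open>\<phi>\<^sub>a(z)\<close>.\<close>

fun dphi :: "nat \<Rightarrow> nat \<Rightarrow> int \<Rightarrow> 'k bk"
  where
    "dphi 0 a e = phi a (- e)"
  | "dphi (Suc m) a e = bscale (of_int (e + 1)) (dphi m a (e + 1))"

text \<open>The coefficient of the \<open>e\<close>-th power of \<open>z\<close> in the product of \<open>\<phi>\<^sub>0(z)\<close> and the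
  \<open>(k-2)\<close>-nd derivative of \<open>\<phi>\<^sub>0(z)\<close> is the sum of \<open>dphi 0 0 (e - j) * dphi (k - 2) 0 j\<close>
  over all integers \<open>j\<close>. As \<open>dphi m 0 j\<close> is a multiple of \<open>phi 0 (- j - m)\<close>, at level \<open>N\<close> only
  \<open>j \<le> e + N\<close> and \<open>j \<ge> - N - (k - 2)\<close> contribute.\<close>

definition quad_field :: "int \<Rightarrow> int \<Rightarrow> 'k bk set"
  where "quad_field e = (\<lambda>N.
    (\<Sum>j\<in>{- N - (int CARD('k) - 2)..e + N}. dphi 0 0 (e - j) * dphi (CARD('k) - 2) 0 j)
      +o bgr_ideal 2 N)"

inductive_set quad_rel :: "(int \<Rightarrow> 'k bk set) set"
  where
    field: "quad_field e \<in> quad_rel"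
  | zero: "bbar_zero 2 \<in> quad_rel"
  | add: "x \<in> quad_rel \<Longrightarrow> y \<in> quad_rel \<Longrightarrow> bbar_add x y \<in> quad_rel"
  | scale: "x \<in> quad_rel \<Longrightarrow> bbar_scale 2 c x \<in> quad_rel"
  | act: "x \<in> quad_rel \<Longrightarrow> bbar_act 2 X x \<in> quad_rel"


section \<open>The quotient space \<open>\<H>\<close>\<close>

definition nspace :: "nat \<Rightarrow> nat \<Rightarrow> 'k bk set"
  where "nspace r s = bk.span
    {x * phi a n | x a n. x \<in> bgr (s - 1) \<and> a \<le> CARD('k) \<and> min (int a - int r) 0 < n}"

text \<open>The subspace of \<open>bgr s\<close> by which \<open>\<H>\<close> is the quotient: it is spanned by \<open>nspace r s\<close> and the
  representatives of all products of the completed degree \<open>s - 2\<close> part with the quadratic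
  relations. Level \<open>0\<close> of an element of the completion is its image modulo \<open>bgr_ideal s 0\<close>, and
  \<open>bgr_ideal s 0 \<subseteq> nspace r s\<close>.\<close>

definition hker :: "nat \<Rightarrow> nat \<Rightarrow> 'k bk set"
  where "hker r s = bk.span (nspace r s \<union>
    (if s < 2 then {} else \<Union>{bbar_mult s x y 0 | x y. x \<in> bbar (s - 2) \<and> y \<in> quad_rel}))"

definition hvec :: "nat \<Rightarrow> nat \<Rightarrow> 'k bk \<Rightarrow> 'k bk set"
  where "hvec r s x = x +o hker r s"

definition hspace :: "nat \<Rightarrow> nat \<Rightarrow> 'k bk set set"
  where "hspace r s = hvec r s ` bgr s"

text \<open>The sum in \<open>\<H>\<close> is the elementwise sum of cosets, and the zero vector is \<open>hker r s\<close>.\<close>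

definition hscale :: "nat \<Rightarrow> nat \<Rightarrow> complex \<Rightarrow> 'k bk set \<Rightarrow> 'k bk set"
  where "hscale r s c A = bscale c ` A + hker r s"

text \<open>Linear independence of a family; in particular its members are pairwise distinct.\<close>

definition hindependent :: "nat \<Rightarrow> nat \<Rightarrow> ('i \<Rightarrow> 'k bk set) \<Rightarrow> 'i set \<Rightarrow> bool"
  where "hindependent r s v I \<longleftrightarrow> v ` I \<subseteq> hspace r s \<and>
    (\<forall>F c. finite F \<and> F \<subseteq> I \<and> (\<Sum>i\<in>F. hscale r s (c i) (v i)) = hker r s \<longrightarrow> (\<forall>i\<in>F. c i = 0))"

text \<open>The letters of a word are numbered from \<open>0\<close>.\<close>

definition normal_words :: "nat \<Rightarrow> nat \<Rightarrow> nat \<Rightarrow> (nat \<times> int) list set"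
  where "normal_words k r s = {w. length w = s \<and> (\<forall>(a, n)\<in>set w. a \<le> k) \<and>
    (\<forall>j. Suc j < s \<longrightarrow>
      (let (a, n) = w ! j; (a', n') = w ! Suc j
       in int k \<le> min (int a) (int k - int a') - n + n')) \<and>
    (let (a, n) = last w in n \<le> min (int a - int r) 0)}"

end

theory Submission
  imports Defs "HOL-Library.FuncSet"
begin

text \<open>The relations of \<open>B\<^sub>k\<close> hold for the product of \<open>k\<close> independent fermions
  \<open>\<psi>(u, z) = \<psi>\<^sub>0(z) + u \<psi>\<^sub>1(z)\<close>, where \<open>\<phi>\<^sub>a(z)\<close> is the coefficient of the \<open>a\<close>-th power of \<open>u\<close>: the affine
  algebra acts on each fermion by derivations, and the quadratic relation holds because \<open>k - 2\<close>
  derivatives cannot separate all \<open>k\<close> coinciding pairs \<open>\<psi>\<^sub>0(z) \<psi>\<^sub>0(z) = 0\<close>. Matrix coefficients, that is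
  products of \<open>k\<close> determinants, are therefore functionals that vanish on the quadratic relations, and
  they vanish on \<open>nspace\<close> if the modes are positive enough.

  The inequalities of a normal word are exactly what is needed to write every letter as a sum of \<open>k\<close>
  modes, strictly decreasing along the word in each factor. The resulting functional takes the value
  \<open>1\<close> on that word, and on any other word it vanishes unless the word is smaller in a lexicographic
  order; so the matrix of values on normal words is triangular.\<close>

subsection \<open>Linear functionals on \<open>B\<^sub>k\<close>\<close>

definition word_sum :: "((nat \<times> int) list \<Rightarrow> complex) \<Rightarrow> falg \<Rightarrow> complex"
  where "word_sum G p = (\<Sum>w\<in>Poly_Mapping.keys p. Poly_Mapping.lookup p w * G (letters w))"

lemma word_sum_superset:
  assumes "finite A" "Poly_Mapping.keys p \<subseteq> A"
  shows "word_sum G p = (\<Sum>w\<in>A. Poly_Mapping.lookup p w * G (letters w))"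
  unfolding word_sum_def
  by (rule sum.mono_neutral_left) (use assms in \<open>auto simp: in_keys_iff\<close>)

lemma word_sum_zero: "word_sum G 0 = 0"
  by (simp add: word_sum_def)

lemma word_sum_add: "word_sum G (p + q) = word_sum G p + word_sum G q"
proof -
  let ?A = "Poly_Mapping.keys p \<union> Poly_Mapping.keys q"
  have "Poly_Mapping.keys (p + q) \<subseteq> ?A"
    by (rule keys_add)
  then show ?thesis
    by (simp add: word_sum_superset[where A = ?A] lookup_add distrib_right sum.distrib)
qed

lemma word_sum_scale: "word_sum G (fconst c * p) = c * word_sum G p"
proof -
  have "Poly_Mapping.keys (fconst c * p) \<subseteq> Poly_Mapping.keys p"
    by (auto simp: in_keys_iff lookup_fconst_mult)
  then show ?thesis
    by (simp add: word_sum_superset[where A = "Poly_Mapping.keys p"] lookup_fconst_mult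
        sum_distrib_left mult.assoc)
qed

lemma word_sum_diff: "word_sum G (p - q) = word_sum G p - word_sum G q"
  using word_sum_add[of G "p - q" q] by simp

lemma word_sum_fword: "word_sum G (fword w) = G w"
  by (simp add: word_sum_def fword_def)

text \<open>The two clauses dualise the two families of \<open>relators\<close>; they hold inside
  arbitrary words, so such a \<open>G\<close> descends to the quotient algebra.\<close>

definition word_functional :: "nat \<Rightarrow> ((nat \<times> int) list \<Rightarrow> complex) \<Rightarrow> bool"
  where "word_functional k G \<longleftrightarrow>
    (\<forall>u x y v. G (u @ x # y # v) = (- 1) ^ k * G (u @ y # x # v)) \<and>
    (\<forall>w. (\<exists>(a, n)\<in>set w. k < a) \<longrightarrow> G w = 0)"

lemma word_functional_prefix: "word_functional k G \<Longrightarrow> word_functional k (\<lambda>w. G (u @ w))"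
  unfolding word_functional_def append_assoc[symmetric] by (metis (no_types) Un_iff set_append)

lemma fconst_sign: "fconst ((- 1) ^ k) = (- 1) ^ k"
  by (induction k) (simp_all add: fconst_simps)

text \<open>By bilinearity both outer factors of a generator of the ideal may be taken to be words;
  multiplied out, a relator becomes a combination of words to which one clause of
  \<open>word_functional\<close> applies.\<close>

lemma word_sum_ideal:
  assumes G: "word_functional k G" and p: "p \<in> two_sided_ideal (relators k)"
  shows "word_sum G p = 0"
  using p
proof (induction rule: two_sided_ideal.induct)
  case (gen x u v)
  have "word_sum G (fword us * x * fword vs) = 0" for us vs
  proof -
    from gen consider
      (rel) a b m n where "x = fgen a m * fgen b n - (- 1) ^ k * (fgen b n * fgen a m)"
    | (kill) a n where "x = fgen a n" "k < a"
      unfolding relators_def by blast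
    then show ?thesis
    proof cases
      case rel
      have word: "fword us * (fword [x] * fword [y]) * fword vs = fword (us @ x # y # vs)" for x y
        by (simp flip: fword_append)
      have "fword us * x * fword vs = fword (us @ (a, m) # (b, n) # vs)
          - fconst ((- 1) ^ k) * fword (us @ (b, n) # (a, m) # vs)"
        unfolding rel fgen_def right_diff_distrib left_diff_distrib fconst_sign[symmetric]
          fconst_central_left mult.assoc[of "fconst c" for c] word ..
      moreover have "G (us @ (a, m) # (b, n) # vs) = (- 1) ^ k * G (us @ (b, n) # (a, m) # vs)"
        using G unfolding word_functional_def by blast
      ultimately show ?thesis
        by (simp add: word_sum_diff word_sum_scale word_sum_fword)
    next
      case kill
      have "fword us * x * fword vs = fword (us @ (a, n) # vs)"
        by (simp add: kill fgen_def flip: fword_append)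
      moreover have "\<exists>(a, n)\<in>set (us @ (a, n) # vs). k < a"
        using kill by auto
      then have "G (us @ (a, n) # vs) = 0"
        using G unfolding word_functional_def by blast
      ultimately show ?thesis
        by (simp add: word_sum_fword)
    qed
  qed
  then have "word_sum G (u * x * fword vs) = 0" for vs
    by (induction u rule: falg_induct)
      (simp_all add: distrib_right word_sum_add word_sum_zero word_sum_scale mult.assoc)
  then show ?case
    by (induction v rule: falg_induct)
      (simp_all add: distrib_left word_sum_add word_sum_zero word_sum_scale mult.assoc
        fconst_central_left)
qed (simp_all add: word_sum_zero word_sum_add)

text \<open>Independent of the chosen representative only if \<open>G\<close> is a word functional.\<close>

definition bk_sum :: "((nat \<times> int) list \<Rightarrow> complex) \<Rightarrow> 'k bk \<Rightarrow> complex"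
  where "bk_sum G x = word_sum G (rep_bk x)"

lemma bk_sum_abs:
  assumes "word_functional CARD('k) G"
  shows "bk_sum G (abs_bk p :: 'k bk) = word_sum G p"
proof -
  have "rep_bk (abs_bk p :: 'k bk) - p \<in> two_sided_ideal (relators CARD('k))"
    using Quotient3_rep_abs[OF Quotient3_bk] two_sided_ideal.zero by force
  then have "word_sum G (rep_bk (abs_bk p :: 'k bk) - p) = 0"
    by (rule word_sum_ideal[OF assms])
  then show ?thesis
    by (simp add: bk_sum_def word_sum_diff)
qed

section \<open>Evaluating functionals on monomials\<close>

lemma monomial_Nil: "monomial [] = 1"
  and monomial_Cons: "monomial ((a, n) # w) = phi a n * monomial w"
  and monomial_append: "monomial (u @ v) = monomial u * monomial v"
  by (simp_all add: monomial_def)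

lemma monomial_abs: "monomial w = (abs_bk (fword w) :: 'k bk)"
proof (induction w)
  case Nil
  show ?case
    by (simp add: monomial_Nil fword_Nil one_bk_def)
next
  case (Cons x w)
  obtain a n where x: "x = (a, n)"
    by (cases x)
  have "fword (x # w) = fgen a n * fword w"
    using fword_append[of "[x]" w] by (simp add: x fgen_def)
  then show ?case
    by (simp add: x monomial_Cons Cons phi.abs_eq times_bk.abs_eq)
qed

lemma bk_induct [case_names zero mono add]:
  fixes x :: "'k bk"
  assumes "P 0" "\<And>c w. P (bscale c (monomial w))" "\<And>x y. P x \<Longrightarrow> P y \<Longrightarrow> P (x + y)"
  shows "P x"
proof -
  have "P (abs_bk p)" for p
  proof (induction p rule: falg_induct)
    case (mono c w)
    show ?case
      using assms(2)[of c w] by (simp add: monomial_abs bscale.abs_eq)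
  next
    case (add p q)
    then show ?case
      using assms(3)[of "abs_bk p" "abs_bk q"] by (simp add: plus_bk.abs_eq)
  qed (use assms(1) in \<open>simp add: zero_bk_def\<close>)
  then show ?thesis
    by (metis Quotient3_abs_rep[OF Quotient3_bk])
qed

context
  fixes G :: "(nat \<times> int) list \<Rightarrow> complex"
  assumes G: "word_functional CARD('k) G"
begin

lemma bk_sum_zero: "bk_sum G (0 :: 'k bk) = 0"
  by (simp add: zero_bk_def bk_sum_abs G word_sum_zero)

lemma bk_sum_add: "bk_sum G (x + y :: 'k bk) = bk_sum G x + bk_sum G y"
proof -
  obtain p q where "x = abs_bk p" "y = abs_bk q"
    by (metis Quotient3_abs_rep[OF Quotient3_bk])
  then show ?thesis
    by (simp add: plus_bk.abs_eq bk_sum_abs G word_sum_add)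
qed

lemma bk_sum_scale: "bk_sum G (bscale c x :: 'k bk) = c * bk_sum G x"
proof -
  obtain p where "x = abs_bk p"
    by (metis Quotient3_abs_rep[OF Quotient3_bk])
  then show ?thesis
    by (simp add: bscale.abs_eq bk_sum_abs G word_sum_scale)
qed

lemma bk_sum_monomial: "bk_sum G (monomial w :: 'k bk) = G w"
  by (simp add: monomial_abs bk_sum_abs G word_sum_fword)

lemma bk_sum_sum: "bk_sum G (\<Sum>i\<in>A. f i :: 'k bk) = (\<Sum>i\<in>A. bk_sum G (f i))"
  by (induction A rule: infinite_finite_induct) (simp_all add: bk_sum_zero bk_sum_add)

lemma bk_sum_span:
  assumes "\<And>y. y \<in> Y \<Longrightarrow> bk_sum G y = 0" "(x :: 'k bk) \<in> bk.span Y"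
  shows "bk_sum G x = 0"
  using assms(2) by (induction rule: bk.span_induct_alt)
    (simp_all add: bk_sum_zero bk_sum_add bk_sum_scale assms(1))

lemma bk_sum_ideal:
  assumes "\<And>u v a m. N < m \<Longrightarrow> G (u @ (a, m) # v) = 0" "(x :: 'k bk) \<in> bideal N"
  shows "bk_sum G x = 0"
  using assms(2) unfolding bideal_def
proof (induction rule: two_sided_ideal.induct)
  case (gen x u v)
  then obtain a m where x: "x = phi a m" "N < m"
    by auto
  have "bk_sum G (monomial us * x * monomial vs) = 0" for us vs
  proof -
    have "monomial us * x * monomial vs = monomial (us @ (a, m) # vs)"
      by (simp add: x monomial_append monomial_Cons mult.assoc)
    with x show ?thesis
      by (simp add: bk_sum_monomial assms(1))
  qed
  then have "bk_sum G (u * x * monomial vs) = 0" for vs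
    by (induction u rule: bk_induct)
      (simp_all add: distrib_right bk_sum_add bk_sum_zero bk_sum_scale bscale_mult)
  then show ?case
    by (induction v rule: bk_induct)
      (simp_all add: distrib_left bk_sum_add bk_sum_zero bk_sum_scale bscale_mult)
qed (simp_all add: bk_sum_zero bk_sum_add)

end

text \<open>Moves a left factor into the functional, so that a product with a quadratic relation is
  tested by a functional of the remaining letters.\<close>

lemma bk_sum_prefix:
  assumes "word_functional CARD('k) G"
  shows "bk_sum G (monomial u * v :: 'k bk) = bk_sum (\<lambda>w. G (u @ w)) v"
proof -
  have "word_functional CARD('k) (\<lambda>w. G (u @ w))"
    by (rule word_functional_prefix[OF assms])
  with assms show ?thesis
    by (induction v rule: bk_induct)
      (simp_all add: distrib_left bk_sum_add bk_sum_zero bk_sum_scale bscale_mult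
        bk_sum_monomial flip: monomial_append)
qed

lemma bk_sum_linear: "finite I \<Longrightarrow> bk_sum (\<lambda>w. \<Sum>i\<in>I. c i * G i w) x = (\<Sum>i\<in>I. c i * bk_sum (G i) x)"
  unfolding bk_sum_def word_sum_def
  by (simp add: sum_distrib_left mult.left_commute sum.swap[where B = I])

subsection \<open>Pairs of modes\<close>

text \<open>The sum is an iterated finite difference, with steps \<open>d x\<close> for
  \<open>x\<close> in \<open>K\<close>, of a polynomial of degree \<open>length As\<close>. Each
  difference lowers the degree, so \<open>card K\<close> of them leave zero.\<close>

lemma alternating_sum_prod_list:
  fixes d :: "'a \<Rightarrow> 'b::comm_ring_1"
  assumes "finite K" "length As < card K"
  shows "(\<Sum>S\<in>Pow K. (- 1) ^ card S * prod_list (map (\<lambda>c. c + sum d S) As)) = 0"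
  using assms
proof (induction K arbitrary: As rule: finite_induct)
  case (insert x K)
  let ?P = "\<lambda>As y. prod_list (map (\<lambda>c. c + y) As)"
  \<comment> \<open>Pairing \<open>S\<close> with \<open>insert x S\<close> takes the difference in
    direction \<open>x\<close>. The empty product is the initial value of the accumulator
    \<open>Bs\<close> below.\<close>
  have split: "(\<Sum>S\<in>Pow (insert x K). (- 1) ^ card S * ?P As (sum d S))
    = (\<Sum>S\<in>Pow K. (- 1) ^ card S * (?P [] (sum d S) * (?P As (sum d S) - ?P As (sum d S + d x))))"
  proof -
    have "(\<Sum>S\<in>insert x ` Pow K. (- 1) ^ card S * ?P As (sum d S))
        = (\<Sum>S\<in>Pow K. (- 1) ^ card (insert x S) * ?P As (sum d (insert x S)))"
      by (rule sum.reindex_cong[OF _ refl refl]) (use insert.hyps in \<open>auto simp: inj_on_def\<close>)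
    also have "\<dots> = (\<Sum>S\<in>Pow K. - ((- 1) ^ card S * ?P As (sum d S + d x)))"
    proof (rule sum.cong[OF refl])
      fix S
      assume "S \<in> Pow K"
      with insert.hyps have "finite S" "x \<notin> S"
        by (auto intro: finite_subset)
      then show "(- 1) ^ card (insert x S) * ?P As (sum d (insert x S))
          = - ((- 1) ^ card S * ?P As (sum d S + d x))"
        by (simp add: add.commute)
    qed
    moreover have "Pow K \<inter> insert x ` Pow K = {}"
      using insert.hyps by auto
    ultimately show ?thesis
      using insert.hyps by (simp add: Pow_insert sum.union_disjoint right_diff_distrib
          sum_subtractf sum_negf)
  qed
  \<comment> \<open>The difference of the product is expanded factor by factor: \<open>Bs\<close>
    holds the factors already passed, and each step splits off a product of fewer than
    \<open>card K\<close> factors, which the outer induction hypothesis kills.\<close>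
  have "(\<Sum>S\<in>Pow K. (- 1) ^ card S * (?P Bs (sum d S) * (?P As (sum d S) - ?P As (sum d S + d x)))) = 0"
    if "length Bs + length As \<le> card K" for Bs
    using that
  proof (induction As arbitrary: Bs)
    case (Cons c As)
    have shift: "?P (map (\<lambda>c. c + d x) As) y = ?P As (y + d x)" for y
      by (simp add: comp_def algebra_simps)
    have "?P (c # As) y - ?P (c # As) (y + d x)
        = (c + y) * (?P As y - ?P As (y + d x)) - d x * ?P (map (\<lambda>c. c + d x) As) y" for y
      unfolding shift by (simp add: algebra_simps)
    then have "(\<Sum>S\<in>Pow K. (- 1) ^ card S *
          (?P Bs (sum d S) * (?P (c # As) (sum d S) - ?P (c # As) (sum d S + d x))))
        = (\<Sum>S\<in>Pow K. (- 1) ^ card S *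
          (?P (Bs @ [c]) (sum d S) * (?P As (sum d S) - ?P As (sum d S + d x))))
        - d x * (\<Sum>S\<in>Pow K. (- 1) ^ card S * ?P (Bs @ map (\<lambda>c. c + d x) As) (sum d S))"
      by (simp only: map_append prod_list.append shift)
        (simp add: algebra_simps sum_distrib_left sum_subtractf sum.distrib)
    also have "\<dots> = 0"
      using Cons.IH[of "Bs @ [c]"] insert.IH[of "Bs @ map (\<lambda>c. c + d x) As"] Cons.prems by simp
    finally show ?case .
  qed simp
  from this[of "[]"] insert show ?case
    unfolding split by simp
qed simp

lemma sum_of_bool_single:
  assumes "finite J" "C \<Longrightarrow> j0 \<in> J"
  shows "(\<Sum>j\<in>J. P j * of_bool (C \<and> j = j0)) = (of_bool C * P j0 :: 'b::comm_semiring_1)"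
  using assms by (cases C) (simp_all add: of_bool_def if_distrib cong: if_cong)

text \<open>An integer \<open>2 * m + \<epsilon>\<close> with \<open>\<epsilon> \<in> {0, 1}\<close> encodes the mode \<open>u\<close> to the power \<open>\<epsilon>\<close> times \<open>z\<close> to the
  power \<open>m\<close> of one fermion. One mode in each of the \<open>k\<close> factors contributes to \<open>\<phi>\<^sub>a\<^sub>,\<^sub>n\<close> with \<open>a\<close> the
  total exponent of \<open>u\<close> and \<open>- n\<close> that of \<open>z\<close>.\<close>

definition letter :: "('k \<Rightarrow> int) \<Rightarrow> nat \<times> int"
  where "letter t = (card {i. odd (t i)}, - (\<Sum>i\<in>UNIV. t i div 2))"

definition mix :: "'k set \<Rightarrow> ('k \<Rightarrow> int) \<Rightarrow> ('k \<Rightarrow> int) \<Rightarrow> 'k \<Rightarrow> int"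
  where "mix S f g i = (if i \<in> S then g i else f i)"

text \<open>The coefficient functional of the product over \<open>i\<close> of the antisymmetrised pairs of modes
  \<open>f i\<close>, \<open>g i\<close>. If the two coincide for some \<open>i\<close>, it vanishes.\<close>

definition pairing :: "('k \<Rightarrow> int) \<Rightarrow> ('k \<Rightarrow> int) \<Rightarrow> (nat \<times> int) list \<Rightarrow> complex"
  where "pairing f g w =
    (\<Sum>S\<in>UNIV. (- 1) ^ card S * of_bool (w = [letter (mix S f g), letter (mix S g f)]))"

text \<open>Both letters of a pairing then have mode number at most \<open>N\<close>, however the
  modes are distributed, so the pairing kills level \<open>N\<close> of the filtration.\<close>

definition level_above :: "('k \<Rightarrow> int) \<Rightarrow> ('k \<Rightarrow> int) \<Rightarrow> int \<Rightarrow> bool"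
  where "level_above f g N \<longleftrightarrow> - N \<le> (\<Sum>i\<in>UNIV. min (f i div 2) (g i div 2))"

lemma pairing_length: "length w \<noteq> 2 \<Longrightarrow> pairing f g w = 0"
  unfolding pairing_def by (intro sum.neutral) auto

text \<open>The transpose of the action on a single mode: \<open>e\<close> goes to \<open>entry_coeff X e\<close> times
  \<open>entry_move X e\<close>. The action on \<open>\<phi>\<^sub>a\<^sub>,\<^sub>n\<close> is the sum of these over the factors.\<close>

fun entry_coeff :: "affine_basis \<Rightarrow> int \<Rightarrow> complex"
  where
    "entry_coeff (Loop sl2_E j) e = of_bool (even e)"
  | "entry_coeff (Loop sl2_H j) e = (if odd e then - 1 else 1)"
  | "entry_coeff (Loop sl2_F j) e = of_bool (odd e)"
  | "entry_coeff Central e = 0"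
  | "entry_coeff Degree e = - of_int (e div 2)"

fun entry_move :: "affine_basis \<Rightarrow> int \<Rightarrow> int"
  where
    "entry_move (Loop sl2_E j) e = e + 1 + 2 * j"
  | "entry_move (Loop sl2_H j) e = e + 2 * j"
  | "entry_move (Loop sl2_F j) e = e - 1 + 2 * j"
  | "entry_move Central e = e"
  | "entry_move Degree e = e"

text \<open>The coefficient excludes the one bad case: \<open>sl2_F\<close> on an even entry would
  cost one more power of z.\<close>

lemma entry_move_bound: "entry_coeff X e \<noteq> 0 \<Longrightarrow> e div 2 - shift X \<le> entry_move X e div 2"
  by (cases "(X, e)" rule: entry_coeff.cases) (auto elim!: evenE oddE)

context
  assumes fin: "finite (UNIV :: 'k set)"
begin

lemma letter_le: "letter (t :: 'k \<Rightarrow> int) = (a, n) \<Longrightarrow> a \<le> CARD('k)"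
  using card_mono[OF fin] by (auto simp: letter_def)

lemma card_odd:
  "of_nat (card {i :: 'k. odd (t i :: int)}) = (\<Sum>i\<in>UNIV. of_bool (odd (t i)) :: 'b::semiring_1)"
  by (simp add: fin)

lemma letter_upd:
  fixes t :: "'k \<Rightarrow> int"
  assumes "letter t = (a, n)"
  shows "letter (t(i := e)) = (b, m) \<longleftrightarrow>
    int b = int a - of_bool (odd (t i)) + of_bool (odd e) \<and> m = n + t i div 2 - e div 2"
proof -
  have upd: "(\<Sum>j\<in>UNIV. h ((t(i := e)) j)) = (\<Sum>j\<in>UNIV. h (t j)) - h (t i) + h e" for h :: "int \<Rightarrow> int"
  proof -
    have "(\<Sum>j\<in>UNIV - {i}. h ((t(i := e)) j)) = (\<Sum>j\<in>UNIV - {i}. h (t j))"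
      by (rule sum.cong) auto
    then show ?thesis
      using sum.remove[OF fin, of i "\<lambda>j. h ((t(i := e)) j)"] sum.remove[OF fin, of i "\<lambda>j. h (t j)"]
      by simp
  qed
  have "int (card {j. odd ((t(i := e)) j)}) = int a - of_bool (odd (t i)) + of_bool (odd e)"
    using upd[of "\<lambda>x. of_bool (odd x)"] assms by (simp only: card_odd[symmetric] letter_def prod.inject)
  moreover have "- (\<Sum>j\<in>UNIV. (t(i := e)) j div 2) = n + t i div 2 - e div 2"
    using upd[of "\<lambda>x. x div 2"] assms unfolding letter_def prod.inject by linarith
  ultimately show ?thesis
    unfolding letter_def prod.inject by (metis of_nat_eq_iff)
qed

lemma sum_odd: "(\<Sum>i\<in>UNIV. of_bool (odd (t i :: int)) :: complex) = of_nat (fst (letter (t :: 'k \<Rightarrow> int)))"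
  by (simp add: letter_def card_odd)

text \<open>The sl2 multipliers count factors: \<open>CARD('k) - a + 1\<close> counts the even
  entries of a tuple with \<open>a - 1\<close> odd ones, \<open>a + 1\<close> the odd entries of a
  tuple with \<open>a + 1\<close> of them, and \<open>CARD('k) - 2 * a\<close> is the number of even
  minus that of odd entries.\<close>

lemma act_phi_dual:
  obtains c a' n' where "act X (phi a n :: 'k bk) = bscale c (phi a' n')"
    "\<And>t :: 'k \<Rightarrow> int. c * of_bool (letter t = (a', n')) =
      (\<Sum>i\<in>UNIV. entry_coeff X (t i) * of_bool (letter (t(i := entry_move X (t i))) = (a, n)))"
proof (cases X)
  case (Loop Y j)
  show ?thesis
  proof (cases Y)
    case sl2_E
    show ?thesis
    proof (rule that)
      show "act X (phi a n :: 'k bk) = bscale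
          (if a = 0 then 0 else of_nat CARD('k) - of_nat a + 1) (phi (a - 1) (n + j))"
        by (simp add: Loop sl2_E act_phi)
    next
      fix t :: "'k \<Rightarrow> int"
      have sum: "(\<Sum>i\<in>UNIV. of_bool (even (t i)) :: complex) = of_nat CARD('k) - of_nat (fst (letter t))"
      proof -
        have "(\<Sum>i\<in>UNIV. of_bool (even (t i)) :: complex) = (\<Sum>i\<in>UNIV. 1 - of_bool (odd (t i)))"
          by (rule sum.cong) auto
        then show ?thesis
          by (simp add: sum_subtractf sum_odd)
      qed
      \<comment> \<open>At \<open>a = 0\<close> truncated subtraction makes \<open>a - 1\<close>
        equal to \<open>0\<close>, hence the explicit condition \<open>a \<noteq> 0\<close>.\<close>
      have "(\<Sum>i\<in>UNIV. entry_coeff X (t i) * of_bool (letter (t(i := entry_move X (t i))) = (a, n)))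
          = (\<Sum>i\<in>UNIV. of_bool (even (t i)) * of_bool (a \<noteq> 0 \<and> letter t = (a - 1, n + j)) :: complex)"
        by (cases "letter t", rule sum.cong) (auto simp: Loop sl2_E letter_upd elim!: evenE)
      also have "\<dots> = (if a = 0 then 0 else of_nat CARD('k) - of_nat a + 1)
          * of_bool (letter t = (a - 1, n + j))"
        unfolding sum_distrib_right[symmetric] sum by auto
      finally show "(if a = 0 then 0 else of_nat CARD('k) - of_nat a + 1)
          * of_bool (letter t = (a - 1, n + j)) =
        (\<Sum>i\<in>UNIV. entry_coeff X (t i) * of_bool (letter (t(i := entry_move X (t i))) = (a, n)))"
        by simp
    qed
  next
    case sl2_H
    show ?thesis
    proof (rule that)
      show "act X (phi a n :: 'k bk) = bscale (of_nat CARD('k) - 2 * of_nat a) (phi a (n + j))"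
        by (simp add: Loop sl2_H act_phi)
    next
      fix t :: "'k \<Rightarrow> int"
      have sum: "(\<Sum>i\<in>UNIV. if odd (t i) then - 1 else 1 :: complex)
          = of_nat CARD('k) - 2 * of_nat (fst (letter t))"
      proof -
        have "(\<Sum>i\<in>UNIV. if odd (t i) then - 1 else 1 :: complex)
            = (\<Sum>i\<in>UNIV. 1 - 2 * of_bool (odd (t i)))"
          by (rule sum.cong) auto
        then show ?thesis
          by (simp add: sum_subtractf sum_odd flip: sum_distrib_left)
      qed
      have "(\<Sum>i\<in>UNIV. entry_coeff X (t i) * of_bool (letter (t(i := entry_move X (t i))) = (a, n)))
          = (\<Sum>i\<in>UNIV. (if odd (t i) then - 1 else 1) * of_bool (letter t = (a, n + j)) :: complex)"
        by (cases "letter t", rule sum.cong) (auto simp: Loop sl2_H letter_upd)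
      also have "\<dots> = (of_nat CARD('k) - 2 * of_nat a) * of_bool (letter t = (a, n + j))"
        unfolding sum_distrib_right[symmetric] sum by auto
      finally show "(of_nat CARD('k) - 2 * of_nat a) * of_bool (letter t = (a, n + j)) =
        (\<Sum>i\<in>UNIV. entry_coeff X (t i) * of_bool (letter (t(i := entry_move X (t i))) = (a, n)))"
        by simp
    qed
  next
    case sl2_F
    show ?thesis
    proof (rule that)
      show "act X (phi a n :: 'k bk) = bscale (of_nat a + 1) (phi (a + 1) (n + j))"
        by (simp add: Loop sl2_F act_phi)
    next
      fix t :: "'k \<Rightarrow> int"
      have "(\<Sum>i\<in>UNIV. entry_coeff X (t i) * of_bool (letter (t(i := entry_move X (t i))) = (a, n)))
          = (\<Sum>i\<in>UNIV. of_bool (odd (t i)) * of_bool (letter t = (a + 1, n + j)) :: complex)"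
        by (cases "letter t", rule sum.cong) (auto simp: Loop sl2_F letter_upd elim!: oddE)
      also have "\<dots> = (of_nat a + 1) * of_bool (letter t = (a + 1, n + j))"
        unfolding sum_distrib_right[symmetric] sum_odd by auto
      finally show "(of_nat a + 1) * of_bool (letter t = (a + 1, n + j)) =
        (\<Sum>i\<in>UNIV. entry_coeff X (t i) * of_bool (letter (t(i := entry_move X (t i))) = (a, n)))"
        by simp
    qed
  qed
next
  case Central
  show ?thesis
    by (rule that[of 0]) (simp_all add: Central act_phi)
next
  case Degree
  show ?thesis
  proof (rule that)
    show "act X (phi a n :: 'k bk) = bscale (of_int n) (phi a n)"
      by (simp add: Degree act_phi)
  next
    fix t :: "'k \<Rightarrow> int"
    have "(\<Sum>i\<in>UNIV. - of_int (t i div 2) :: complex) = of_int (snd (letter t))"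
      by (simp add: letter_def sum_negf)
    then show "of_int n * of_bool (letter t = (a, n)) =
      (\<Sum>i\<in>UNIV. entry_coeff X (t i) * of_bool (letter (t(i := entry_move X (t i))) = (a, n)))"
      by (auto simp: Degree simp flip: sum_distrib_right)
  qed
qed

text \<open>Exchanging the letters replaces \<open>S\<close> by its complement, which changes the
  sign by the parity of \<open>CARD('k)\<close>; and no tuple has more than \<open>CARD('k)\<close>
  odd entries.\<close>

lemma pairing_functional: "word_functional CARD('k) (pairing f (g :: 'k \<Rightarrow> int))"
  unfolding word_functional_def
proof (intro conjI allI impI)
  fix u v and x y :: "nat \<times> int"
  show "pairing f g (u @ x # y # v) = (- 1) ^ CARD('k) * pairing f g (u @ y # x # v)"
  proof (cases "u = [] \<and> v = []")
    case True
    have sign: "(- 1) ^ card (- S) = (- 1) ^ CARD('k) * (- 1 :: complex) ^ card S" for S :: "'k set"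
    proof -
      have "card (- S) + card S = CARD('k)"
        using card_Un_disjoint[of "- S" S] finite_subset[OF subset_UNIV fin] by (simp add: Un_commute)
      then have "even (card (- S)) \<longleftrightarrow> (even CARD('k) \<longleftrightarrow> even (card S))"
        by presburger
      then show ?thesis
        by (cases "even (card S)"; cases "even CARD('k)") auto
    qed
    have "pairing f g [x, y]
        = (\<Sum>S\<in>UNIV. (- 1) ^ card (- S) * of_bool ([x, y] = [letter (mix (- S) f g), letter (mix (- S) g f)]))"
      unfolding pairing_def
      by (rule sum.reindex_bij_witness[where i = uminus and j = uminus]) auto
    also have "\<dots> = (- 1) ^ CARD('k) * pairing f g [y, x]"
    proof -
      have "mix (- S) f g = mix S g f" "mix (- S) g f = mix S f g" for S
        by (auto simp: mix_def)
      then show ?thesis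
        unfolding pairing_def sum_distrib_left sign by (intro sum.cong) auto
    qed
    finally show ?thesis
      using True by simp
  next
    case False
    then have "length (u @ x # y # v) \<noteq> 2" "length (u @ y # x # v) \<noteq> 2"
      by auto
    then show ?thesis
      by (metis pairing_length mult_zero_right)
  qed
next
  fix w :: "(nat \<times> int) list"
  assume "\<exists>(a, n)\<in>set w. CARD('k) < a"
  then obtain a n where a: "(a, n) \<in> set w" "CARD('k) < a"
    by auto
  then have "(a, n) \<noteq> letter t" for t :: "'k \<Rightarrow> int"
    using letter_le[of t a n] by auto
  then have "w \<noteq> [letter t, letter t']" for t t' :: "'k \<Rightarrow> int"
    using a(1) by auto
  then show "pairing f g w = 0"
    unfolding pairing_def by (intro sum.neutral) auto
qed

lemma pairing_level:
  assumes "level_above f (g :: 'k \<Rightarrow> int) N" "N < m"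
  shows "pairing f g (u @ (a, m) # v) = 0"
proof -
  have le: "(\<Sum>i\<in>UNIV. min (f i div 2) (g i div 2)) \<le> (\<Sum>i\<in>UNIV. mix S f g i div 2)"
    "(\<Sum>i\<in>UNIV. min (f i div 2) (g i div 2)) \<le> (\<Sum>i\<in>UNIV. mix S g f i div 2)" for S
    by (auto intro!: sum_mono simp: mix_def)
  have "(\<Sum>i\<in>UNIV. mix S f g i div 2) \<noteq> - m" "(\<Sum>i\<in>UNIV. mix S g f i div 2) \<noteq> - m" for S
    using assms le(1)[of S] le(2)[of S] unfolding level_above_def by linarith+
  then have "letter (mix S f g) \<noteq> (a, m)" "letter (mix S g f) \<noteq> (a, m)" for S
    unfolding letter_def by force+
  then have "(a, m) \<notin> set [letter (mix S f g), letter (mix S g f)]" for S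
    by (metis empty_iff empty_set set_ConsD)
  then have "u @ (a, m) # v \<noteq> [letter (mix S f g), letter (mix S g f)]" for S
    by (metis in_set_conv_decomp)
  then show ?thesis
    unfolding pairing_def by (intro sum.neutral) auto
qed


section \<open>The affine action transposed to pairings\<close>

lemma bk_sum_act_length:
  assumes G: "word_functional CARD('k) G" and "\<And>w'. length w' = length u + length w \<Longrightarrow> G w' = 0"
  shows "bk_sum G (monomial u * act X (monomial w) :: 'k bk) = 0"
  using assms(2)
proof (induction w arbitrary: u)
  case Nil
  have "act X (monomial [] :: 'k bk) = 0"
    using act_derivation[of X "1 :: 'k bk" 1] by (simp add: monomial_Nil)
  then show ?case
    by (simp add: bk_sum_zero G)
next
  case (Cons x w)
  obtain a n where x: "x = (a, n)"
    by (cases x)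
  obtain c a' n' where "act X (phi a n :: 'k bk) = bscale c (phi a' n')"
    by (rule act_phi_dual[of X a n])
  then have "monomial u * act X (monomial (x # w) :: 'k bk)
      = bscale c (monomial (u @ (a', n') # w)) + monomial (u @ [x]) * act X (monomial w)"
    by (simp add: x monomial_Cons monomial_append monomial_Nil act_derivation distrib_left
        bscale_mult mult.assoc)
  then show ?case
    using Cons.IH[of "u @ [x]"] Cons.prems by (simp add: bk_sum_add bk_sum_scale bk_sum_monomial G)
qed

lemma pairing_act_letters:
  fixes f g :: "'k \<Rightarrow> int"
  assumes x: "\<And>t :: 'k \<Rightarrow> int. c * of_bool (letter t = x') =
      (\<Sum>i\<in>UNIV. entry_coeff X (t i) * of_bool (letter (t(i := entry_move X (t i))) = x))"
    and y: "\<And>t :: 'k \<Rightarrow> int. d * of_bool (letter t = y') =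
      (\<Sum>i\<in>UNIV. entry_coeff X (t i) * of_bool (letter (t(i := entry_move X (t i))) = y))"
  shows "c * pairing f g [x', y] + d * pairing f g [x, y'] =
    (\<Sum>i\<in>UNIV. entry_coeff X (f i) * pairing (f(i := entry_move X (f i))) g [x, y]
      + entry_coeff X (g i) * pairing f (g(i := entry_move X (g i))) [x, y])"
proof -
  let ?s = "\<lambda>S :: 'k set. (- 1 :: complex) ^ card S"
  let ?L = "\<lambda>t x. of_bool (letter t = x) :: complex"
  let ?m = "\<lambda>t i. t(i := entry_move X (t i))"
  have split: "pairing f g [x, y] = (\<Sum>S\<in>UNIV. ?s S * (?L (mix S f g) x * ?L (mix S g f) y))"
    for f g :: "'k \<Rightarrow> int" and x y
    unfolding pairing_def by (rule sum.cong) auto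
  have "c * pairing f g [x', y] + d * pairing f g [x, y']
      = (\<Sum>S\<in>UNIV. ?s S * ((c * ?L (mix S f g) x') * ?L (mix S g f) y
          + ?L (mix S f g) x * (d * ?L (mix S g f) y')))"
    unfolding split sum_distrib_left sum.distrib[symmetric] by (rule sum.cong) (simp_all add: algebra_simps)
  also have "\<dots> = (\<Sum>S\<in>UNIV. \<Sum>i\<in>UNIV. ?s S *
      (entry_coeff X (mix S f g i) * (?L (?m (mix S f g) i) x * ?L (mix S g f) y)
        + entry_coeff X (mix S g f i) * (?L (mix S f g) x * ?L (?m (mix S g f) i) y)))"
    unfolding x y sum_distrib_left sum_distrib_right sum.distrib[symmetric]
    by (simp add: algebra_simps)
  also have "\<dots> = (\<Sum>S\<in>UNIV. \<Sum>i\<in>UNIV. ?s S *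
      (entry_coeff X (f i) * (?L (mix S (?m f i) g) x * ?L (mix S g (?m f i)) y)
        + entry_coeff X (g i) * (?L (mix S f (?m g i)) x * ?L (mix S (?m g i) f) y)))"
  \<comment> \<open>Membership of \<open>i\<close> in \<open>S\<close> decides which letter carries
    \<open>f i\<close> and which \<open>g i\<close>, so moving one of these two modes affects only
    one letter.\<close>
  proof (intro sum.cong refl arg_cong[where f = "(*) c" for c])
    fix S i
    have "mix S (?m f i) g = (if i \<in> S then mix S f g else ?m (mix S f g) i)"
      "mix S g (?m f i) = (if i \<in> S then ?m (mix S g f) i else mix S g f)"
      "mix S f (?m g i) = (if i \<in> S then ?m (mix S f g) i else mix S f g)"
      "mix S (?m g i) f = (if i \<in> S then mix S g f else ?m (mix S g f) i)"
      "mix S f g i = (if i \<in> S then g i else f i)"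
      "mix S g f i = (if i \<in> S then f i else g i)"
      by (auto simp: mix_def)
    then show "entry_coeff X (mix S f g i) * (?L (?m (mix S f g) i) x * ?L (mix S g f) y)
        + entry_coeff X (mix S g f i) * (?L (mix S f g) x * ?L (?m (mix S g f) i) y) =
      entry_coeff X (f i) * (?L (mix S (?m f i) g) x * ?L (mix S g (?m f i)) y)
        + entry_coeff X (g i) * (?L (mix S f (?m g i)) x * ?L (mix S (?m g i) f) y)"
      by (cases "i \<in> S") (simp_all only: if_True if_False add.commute)
  qed
  also have "\<dots> = (\<Sum>i\<in>UNIV. entry_coeff X (f i) * pairing (?m f i) g [x, y]
      + entry_coeff X (g i) * pairing f (?m g i) [x, y])"
    unfolding split sum_distrib_left sum.distrib[symmetric]
    by (subst sum.swap) (simp add: algebra_simps)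
  finally show ?thesis .
qed

text \<open>Pairings are closed under the transposed action; this makes the induction over the
  invariant subspace \<open>quad_rel\<close> possible.\<close>

lemma pairing_act:
  fixes f g :: "'k \<Rightarrow> int" and v :: "'k bk"
  shows "bk_sum (pairing f g) (act X v) =
    (\<Sum>i\<in>UNIV. entry_coeff X (f i) * bk_sum (pairing (f(i := entry_move X (f i))) g) v
      + entry_coeff X (g i) * bk_sum (pairing f (g(i := entry_move X (g i)))) v)"
proof (induction v rule: bk_induct)
  case zero
  have "act X 0 = (0 :: 'k bk)"
    using act_linear(1)[of X 0 0] by simp
  then show ?case
    by (simp add: bk_sum_zero pairing_functional)
next
  case (mono c w)
  have "bk_sum (pairing f g) (act X (monomial w :: 'k bk)) =
    (\<Sum>i\<in>UNIV. entry_coeff X (f i) * pairing (f(i := entry_move X (f i))) g w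
      + entry_coeff X (g i) * pairing f (g(i := entry_move X (g i))) w)"
  proof (cases "length w = 2")
    case True
    then obtain a m b n where w: "w = [(a, m), (b, n)]"
      by (auto simp: length_Suc_conv numeral_2_eq_2)
    obtain c a' m' where x: "act X (phi a m :: 'k bk) = bscale c (phi a' m')"
      "\<And>t :: 'k \<Rightarrow> int. c * of_bool (letter t = (a', m')) =
        (\<Sum>i\<in>UNIV. entry_coeff X (t i) * of_bool (letter (t(i := entry_move X (t i))) = (a, m)))"
      by (rule act_phi_dual) blast
    obtain d b' n' where y: "act X (phi b n :: 'k bk) = bscale d (phi b' n')"
      "\<And>t :: 'k \<Rightarrow> int. d * of_bool (letter t = (b', n')) =
        (\<Sum>i\<in>UNIV. entry_coeff X (t i) * of_bool (letter (t(i := entry_move X (t i))) = (b, n)))"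
      by (rule act_phi_dual) blast
    have "act X (monomial w :: 'k bk) =
        bscale c (monomial [(a', m'), (b, n)]) + bscale d (monomial [(a, m), (b', n')])"
      by (simp add: w monomial_Cons monomial_Nil act_derivation x(1) y(1) bscale_mult)
    then show ?thesis
      unfolding w pairing_act_letters[OF x(2) y(2), symmetric]
      by (simp add: bk_sum_add bk_sum_scale bk_sum_monomial pairing_functional)
  next
    case False
    then show ?thesis
      using bk_sum_act_length[OF pairing_functional, where u = "[]" and w = w]
      by (simp add: pairing_length monomial_Nil)
  qed
  then show ?case
    unfolding act_linear bk_sum_scale[OF pairing_functional] bk_sum_monomial[OF pairing_functional]
    by (simp only: sum_distrib_left distrib_left mult.left_commute)
next
  case (add x y)
  then show ?case
    unfolding act_linear bk_sum_add[OF pairing_functional]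
    by (simp only: distrib_left sum.distrib add_ac)
qed

subsection \<open>The quadratic relations\<close>

text \<open>The factor is left as a product of \<open>m\<close> linear terms in \<open>j\<close>,
  the form that \<open>alternating_sum_prod_list\<close> takes.\<close>

lemma dphi_eq: "dphi m a j = bscale (prod_list (map (\<lambda>l. of_nat (Suc l) + of_int j) [0..<m])) (phi a (- j - int m))"
proof (induction m arbitrary: j)
  case (Suc m)
  have "prod_list (map (\<lambda>l. of_nat (Suc l) + of_int (j + 1) :: complex) [0..<m])
      = prod_list (map (\<lambda>l. of_nat (Suc l) + of_int j) (map Suc [0..<m]))"
    by (simp add: comp_def algebra_simps)
  then have "prod_list (map (\<lambda>l. of_nat (Suc l) + of_int j :: complex) [0..<Suc m])
      = of_int (j + 1) * prod_list (map (\<lambda>l. of_nat (Suc l) + of_int (j + 1)) [0..<m])"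
    unfolding map_Suc_upt upt_conv_Cons[OF zero_less_Suc] by (simp add: algebra_simps)
  moreover have "- (j + 1) - int m = - j - int (Suc m)"
    by simp
  ultimately show ?case
    by (simp only: dphi.simps Suc.IH bk.scale_scale)
qed simp

text \<open>The derivative has order \<open>k - 2\<close>, so its coefficient is a polynomial of degree less than \<open>k\<close> and
  is killed by the \<open>k\<close>-fold difference that the sum over the subsets \<open>S\<close> amounts to.\<close>

lemma pairing_quad_field:
  fixes f g :: "'k \<Rightarrow> int"
  assumes k: "2 \<le> CARD('k)" and level: "level_above f g N"
  shows "bk_sum (pairing f g) (\<Sum>j\<in>{- N - (int CARD('k) - 2)..e + N}.
    dphi 0 0 (e - j) * dphi (CARD('k) - 2) 0 j :: 'k bk) = 0"
proof -
  let ?k = "CARD('k)" and ?J = "{- N - (int CARD('k) - 2)..e + N}"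
  let ?As = "map (\<lambda>l. of_nat (Suc l)) [0..<?k - 2] :: complex list"
  let ?P = "\<lambda>y :: complex. prod_list (map (\<lambda>c. c + y) ?As)"
  let ?h = "\<lambda>t :: 'k \<Rightarrow> int. \<Sum>i\<in>UNIV. t i div 2"
  let ?tot = "?h f + ?h g"
  have tot: "?h (mix S f g) + ?h (mix S g f) = ?tot" for S
    unfolding sum.distrib[symmetric] by (rule sum.cong) (auto simp: mix_def)
  have lower: "- N \<le> ?h (mix S f g)" "- N \<le> ?h (mix S g f)" for S
  proof -
    have "(\<Sum>i\<in>UNIV. min (f i div 2) (g i div 2)) \<le> ?h (mix S f g)"
      "(\<Sum>i\<in>UNIV. min (f i div 2) (g i div 2)) \<le> ?h (mix S g f)"
      by (auto intro!: sum_mono simp: mix_def)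
    with level show "- N \<le> ?h (mix S f g)" "- N \<le> ?h (mix S g f)"
      unfolding level_above_def by linarith+
  qed
  have mono: "dphi 0 0 (e - j) * dphi (?k - 2) 0 j
      = (bscale (?P (of_int j)) (monomial [(0, j - e), (0, - j - (int ?k - 2))]) :: 'k bk)" for j
    using k by (simp add: dphi_eq[of "?k - 2"] bscale_mult monomial_Cons monomial_Nil comp_def
        of_nat_diff algebra_simps)
  \<comment> \<open>\<open>?C\<close> is the part of the matching condition common to all
    \<open>S\<close>: \<open>phi 0\<close> forces all entries to be even, and the two letters fix
    the total power of z. Only the value of \<open>j\<close> depends on \<open>S\<close>.\<close>
  let ?C = "(\<forall>i. even (f i)) \<and> (\<forall>i. even (g i)) \<and> ?tot = e + int ?k - 2"
  have "bk_sum (pairing f g) (\<Sum>j\<in>?J. dphi 0 0 (e - j) * dphi (?k - 2) 0 j :: 'k bk)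
      = (\<Sum>j\<in>?J. ?P (of_int j) * pairing f g [(0, j - e), (0, - j - (int ?k - 2))])"
    unfolding mono by (simp add: bk_sum_sum bk_sum_scale bk_sum_monomial pairing_functional)
  also have "\<dots> = (\<Sum>S\<in>UNIV. \<Sum>j\<in>?J. (- 1) ^ card S *
      (?P (of_int j) * of_bool ([(0, j - e), (0, - j - (int ?k - 2))]
        = [letter (mix S f g), letter (mix S g f)])))"
    unfolding pairing_def sum_distrib_left
    by (subst sum.swap) (simp only: mult.left_commute)
  also have "\<dots> = (\<Sum>S\<in>UNIV. (- 1) ^ card S * (of_bool ?C * ?P (of_int (?h (mix S g f) - (int ?k - 2)))))"
  proof (rule sum.cong[OF refl])
    fix S :: "'k set"
    let ?j = "?h (mix S g f) - (int ?k - 2)"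
    have zero: "card {i. odd (t i)} = 0 \<longleftrightarrow> (\<forall>i. even (t i))" for t :: "'k \<Rightarrow> int"
      using finite_subset[OF subset_UNIV fin] by auto
    have "(\<forall>i. even (mix S f g i)) \<and> (\<forall>i. even (mix S g f i)) \<longleftrightarrow> (\<forall>i. even (f i)) \<and> (\<forall>i. even (g i))"
      unfolding mix_def by (metis (full_types))
    then have iff: "[(0, j - e), (0, - j - (int ?k - 2))] = [letter (mix S f g), letter (mix S g f)]
        \<longleftrightarrow> ?C \<and> j = ?j" for j
      using tot[of S] by (auto simp: letter_def zero eq_commute[of 0])
    \<comment> \<open>The two bounds in \<open>lower\<close> give the two ends of the truncated
      range \<open>?J\<close>, so truncation at level \<open>N\<close> loses no contributing
      index.\<close>
    have "?C \<Longrightarrow> ?j \<in> ?J"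
      using lower(1)[of S] lower(2)[of S] tot[of S] k by auto
    then have "(\<Sum>j\<in>?J. ?P (of_int j) * of_bool (?C \<and> j = ?j)) = of_bool ?C * ?P (of_int ?j)"
      by (rule sum_of_bool_single[OF finite_atLeastAtMost_int])
    then show "(\<Sum>j\<in>?J. (- 1) ^ card S *
      (?P (of_int j) * of_bool ([(0, j - e), (0, - j - (int ?k - 2))]
        = [letter (mix S f g), letter (mix S g f)])))
      = (- 1) ^ card S * (of_bool ?C * ?P (of_int ?j))"
      unfolding iff sum_distrib_left[symmetric] by simp
  qed
  also have "\<dots> = of_bool ?C * (\<Sum>S\<in>Pow UNIV. (- 1) ^ card S *
      prod_list (map (\<lambda>c. c + (\<Sum>i\<in>S. of_int (f i div 2 - g i div 2)))
        (map (\<lambda>c. c + of_int (?h g - (int ?k - 2))) ?As)))"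
  proof -
    \<comment> \<open>The argument of the polynomial is a constant plus a sum over \<open>S\<close>,
      so what remains is an alternating sum with \<open>CARD('k)\<close> directions and
      \<open>CARD('k) - 2\<close> factors.\<close>
    have "?h (mix S g f) = ?h g + (\<Sum>i\<in>S. f i div 2 - g i div 2)" for S
    proof -
      have "?h (mix S g f) = (\<Sum>i\<in>UNIV. g i div 2 + (if i \<in> S then f i div 2 - g i div 2 else 0))"
        by (rule sum.cong) (auto simp: mix_def)
      also have "\<dots> = ?h g + (\<Sum>i\<in>S. f i div 2 - g i div 2)"
        using sum.inter_restrict[OF fin, of "\<lambda>i. f i div 2 - g i div 2" S]
        by (simp add: sum.distrib)
      finally show ?thesis .
    qed
    then show ?thesis
      unfolding sum_distrib_left Pow_UNIV
      by (intro sum.cong refl) (simp add: comp_def algebra_simps)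
  qed
  also have "\<dots> = 0"
    using alternating_sum_prod_list[OF fin, of "map (\<lambda>c. c + of_int (?h g - (int ?k - 2))) ?As"
        "\<lambda>i. of_int (f i div 2 - g i div 2)"] k
    by (simp del: map_map)
  finally show ?thesis .
qed

text \<open>Matches the deeper representatives that \<open>bbar_act\<close> takes: only the minimum
  at \<open>i\<close> can change, and it falls by at most \<open>shift X\<close>.\<close>

lemma level_above_move:
  fixes f g :: "'k \<Rightarrow> int"
  assumes "level_above f g N"
  shows "entry_coeff X (f i) \<noteq> 0 \<Longrightarrow> level_above (f(i := entry_move X (f i))) g (N + shift X)"
    and "entry_coeff X (g i) \<noteq> 0 \<Longrightarrow> level_above f (g(i := entry_move X (g i))) (N + shift X)"
proof -
  have aux: "level_above f' g' (N + shift X)"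
    if "\<And>j. min (f' j div 2) (g' j div 2) \<ge> min (f j div 2) (g j div 2) - (if j = i then shift X else 0)"
    for f' g'
  proof -
    have "(\<Sum>j\<in>UNIV. min (f j div 2) (g j div 2)) - shift X
        = (\<Sum>j\<in>UNIV. min (f j div 2) (g j div 2) - (if j = i then shift X else 0))"
      by (simp add: sum_subtractf fin)
    also have "\<dots> \<le> (\<Sum>j\<in>UNIV. min (f' j div 2) (g' j div 2))"
      by (rule sum_mono) (rule that)
    finally show ?thesis
      using assms unfolding level_above_def by linarith
  qed
  have "0 \<le> shift X"
    by (cases X) auto
  then show "entry_coeff X (f i) \<noteq> 0 \<Longrightarrow> level_above (f(i := entry_move X (f i))) g (N + shift X)"
    "entry_coeff X (g i) \<noteq> 0 \<Longrightarrow> level_above f (g(i := entry_move X (g i))) (N + shift X)"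
    using entry_move_bound[of X "f i"] entry_move_bound[of X "g i"] by (auto intro!: aux)
qed

lemma pairing_bgr_ideal:
  fixes f g :: "'k \<Rightarrow> int"
  assumes "level_above f g N" "q \<in> bgr_ideal s N"
  shows "bk_sum (pairing f g) (q :: 'k bk) = 0"
  using pairing_level[OF assms(1)] assms(2)
  by (intro bk_sum_ideal[OF pairing_functional, where N = N]) (auto simp: bgr_ideal_def)

text \<open>All pairings and levels are treated at once, because the action step passes to moved
  modes and to level \<open>N + shift X\<close>.\<close>

lemma pairing_quad_rel:
  fixes f g :: "'k \<Rightarrow> int" and v :: "'k bk"
  assumes "2 \<le> CARD('k)" "y \<in> quad_rel" "level_above f g N" "v \<in> y N"
  shows "bk_sum (pairing f g) v = 0"
  using assms(2-4)
proof (induction arbitrary: f g N v rule: quad_rel.induct)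
  case (field e)
  then obtain q where "q \<in> bgr_ideal 2 N"
    "v = (\<Sum>j\<in>{- N - (int CARD('k) - 2)..e + N}. dphi 0 0 (e - j) * dphi (CARD('k) - 2) 0 j) + q"
    by (auto simp: quad_field_def elt_set_plus_def)
  then show ?case
    using pairing_quad_field[OF assms(1) field(1)] pairing_bgr_ideal[OF field(1)]
    by (simp add: bk_sum_add pairing_functional)
next
  case zero
  then show ?case
    by (auto simp: bbar_zero_def intro: pairing_bgr_ideal)
next
  case (add x y)
  then show ?case
    by (auto simp: bbar_add_def set_plus_def bk_sum_add pairing_functional)
next
  case (scale x c)
  then show ?case
    by (auto simp: bbar_scale_def set_plus_def bk_sum_add bk_sum_scale pairing_functional
        pairing_bgr_ideal)
next
  case (act x X)
  then obtain v' q where v: "v = act X v' + q" "v' \<in> x (N + shift X)" "q \<in> bgr_ideal 2 N"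
    by (auto simp: bbar_act_def set_plus_def)
  have "entry_coeff X (f i) * bk_sum (pairing (f(i := entry_move X (f i))) g) v' = 0"
    "entry_coeff X (g i) * bk_sum (pairing f (g(i := entry_move X (g i)))) v' = 0" for i
    by (metis act.IH level_above_move(1)[OF act.prems(1)] v(2) mult_eq_0_iff,
        metis act.IH level_above_move(2)[OF act.prems(1)] v(2) mult_eq_0_iff)
  then have "bk_sum (pairing f g) (act X v') = 0"
    unfolding pairing_act by (simp only: add_0 sum.neutral_const)
  then show ?case
    using act.prems(1) v by (simp add: bk_sum_add pairing_functional pairing_bgr_ideal)
qed

end

subsection \<open>Correlation functions with several rows\<close>

definition choices :: "('k \<Rightarrow> int set) \<Rightarrow> nat \<times> int \<Rightarrow> ('k \<Rightarrow> int) set"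
  where "choices E x = {t. (\<forall>i. t i \<in> E i) \<and> letter t = x}"

text \<open>The sign of a determinant expansion with the modes in decreasing order: the removed mode
  passes all larger ones.\<close>

definition removal_sign :: "('k \<Rightarrow> int set) \<Rightarrow> ('k \<Rightarrow> int) \<Rightarrow> complex"
  where "removal_sign E t = (\<Prod>i\<in>UNIV. (- 1) ^ card {e\<in>E i. t i < e})"

text \<open>Factor \<open>i\<close> is in the state with occupied modes \<open>E i\<close>; a letter removes one mode from every
  factor, and \<open>corr w E\<close> is the vacuum coefficient of what remains after reading \<open>w\<close>. As a function of
  \<open>w\<close> it is the coefficient of a product over \<open>i\<close> of determinants.\<close>

primrec corr :: "(nat \<times> int) list \<Rightarrow> ('k \<Rightarrow> int set) \<Rightarrow> complex"
  where
    "corr [] E = of_bool (\<forall>i. E i = {})"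
  | "corr (x # w) E = (\<Sum>t\<in>choices E x. removal_sign E t * corr w (\<lambda>i. E i - {t i}))"

definition entries :: "('k \<Rightarrow> int) list \<Rightarrow> 'k \<Rightarrow> int set"
  where "entries ts i = (\<lambda>t. t i) ` set ts"

text \<open>The sum of the entries of any tuple with letter \<open>x\<close>, since an entry is its
  parity plus twice its power of z.\<close>

definition key :: "nat \<times> int \<Rightarrow> int"
  where "key x = int (fst x) - 2 * snd x"

lemma corr_Cons_nonzero:
  assumes "corr (x # w) E \<noteq> 0"
  obtains t where "t \<in> choices E x" "corr w (\<lambda>i. E i - {t i}) \<noteq> 0"
proof -
  from assms obtain t where "t \<in> choices E x" "removal_sign E t * corr w (\<lambda>i. E i - {t i}) \<noteq> 0"
    unfolding corr.simps by (rule sum.not_neutral_contains_not_neutral)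
  then show ?thesis
    using that by auto
qed

lemma corr_letters:
  assumes "corr w E \<noteq> 0" "x \<in> set w"
  obtains t where "\<And>i. t i \<in> E i" "x = letter t"
proof -
  have "\<exists>t. (\<forall>i. t i \<in> E i) \<and> x = letter t"
    using assms
  proof (induction w arbitrary: E)
    case (Cons y w)
    then obtain t where "t \<in> choices E y" "corr w (\<lambda>i. E i - {t i}) \<noteq> 0"
      by (blast elim: corr_Cons_nonzero)
    then show ?case
      using Cons.IH[of "\<lambda>i. E i - {t i}"] Cons.prems(2) by (auto simp: choices_def)
  qed simp
  then show ?thesis
    using that by blast
qed

lemma corr_card:
  assumes "corr w E \<noteq> 0" "finite (E i)"
  shows "card (E i) = length w"
  using assms
proof (induction w arbitrary: E)
  case (Cons y w)
  then obtain t where "t \<in> choices E y" "corr w (\<lambda>i. E i - {t i}) \<noteq> 0"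
    by (blast elim: corr_Cons_nonzero)
  then have "t i \<in> E i" "card (E i - {t i}) = length w"
    using Cons.IH[of "\<lambda>i. E i - {t i}"] Cons.prems(2) by (auto simp: choices_def)
  then show ?case
    using Cons.prems(2) by (metis card.remove length_Cons)
qed simp

context
  assumes fin: "finite (UNIV :: 'k set)"
begin

lemma finite_choices:
  assumes "\<And>i :: 'k. finite (E i)"
  shows "finite (choices E x)"
proof (rule finite_subset)
  show "choices E x \<subseteq> PiE UNIV E"
    by (auto simp: choices_def)
  show "finite (PiE UNIV E)"
    by (rule finite_PiE) (use fin assms in auto)
qed

lemma key_letter: "key (letter (t :: 'k \<Rightarrow> int)) = (\<Sum>i\<in>UNIV. t i)"
proof -
  have "(\<Sum>i\<in>UNIV. t i) = (\<Sum>i\<in>UNIV. of_bool (odd (t i)) + 2 * (t i div 2))"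
    by (rule sum.cong) (auto elim!: evenE oddE)
  then show ?thesis
    using card_odd[OF fin, of t, where 'b = int]
    by (simp add: key_def letter_def sum.distrib sum_distrib_left)
qed

text \<open>In each factor the smaller mode passes the larger one in just one of the two orders of
  removal, so every factor contributes -1.\<close>

lemma removal_sign_swap:
  fixes t t' :: "'k \<Rightarrow> int"
  assumes "\<And>i. finite (E i)" "\<And>i. t i \<in> E i" "\<And>i. t' i \<in> E i" "\<And>i. t i \<noteq> t' i"
  shows "removal_sign E t * removal_sign (\<lambda>i. E i - {t i}) t'
    = (- 1) ^ CARD('k) * (removal_sign E t' * removal_sign (\<lambda>i. E i - {t' i}) t)"
proof -
  let ?c = "\<lambda>A e. (- 1 :: complex) ^ card {x \<in> A. e < x}"
  have main: "?c A e * ?c (A - {e}) e' = - (?c A e' * ?c (A - {e'}) e)"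
    if A: "finite A" "e \<in> A" "e' \<in> A" "e < e'" for A and e e' :: int
  proof -
    have "{x \<in> A - {e'}. e < x} = {x \<in> A. e < x} - {e'}" "{x \<in> A - {e}. e' < x} = {x \<in> A. e' < x}"
      using A by auto
    moreover have "card {x \<in> A. e < x} = Suc (card ({x \<in> A. e < x} - {e'}))"
      using A by (intro card.remove) auto
    ultimately show ?thesis
      by simp
  qed
  have sign: "?c A e * ?c (A - {e}) e' = - 1 * (?c A e' * ?c (A - {e'}) e)"
    if "finite A" "e \<in> A" "e' \<in> A" "e \<noteq> e'" for A and e e' :: int
    using main[of A e e'] main[of A e' e] that by (cases "e < e'") auto
  have "(\<Prod>i\<in>UNIV. ?c (E i) (t i) * ?c (E i - {t i}) (t' i))
      = (\<Prod>i\<in>UNIV. - 1 * (?c (E i) (t' i) * ?c (E i - {t' i}) (t i)))"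
    by (intro prod.cong refl sign assms)
  then show ?thesis
    unfolding removal_sign_def by (simp only: prod.distrib prod_constant)
qed

lemma corr_swap_head:
  fixes E :: "'k \<Rightarrow> int set"
  assumes "\<And>i. finite (E i)"
  shows "corr (x # y # v) E = (- 1) ^ CARD('k) * corr (y # x # v) E"
proof -
  let ?R = "\<lambda>E t i. E i - {t i}"
  let ?T = "\<lambda>x y. SIGMA t : choices E x. choices (?R E t) y"
  have expand: "corr (x # y # v) E = (\<Sum>(t, t')\<in>?T x y. removal_sign E t * removal_sign (?R E t) t'
      * corr v (?R (?R E t) t'))" for x y
    by (simp add: sum.Sigma[symmetric] finite_choices assms sum_distrib_left mult.assoc)
  have "corr (x # y # v) E = (\<Sum>(t', t)\<in>?T y x. removal_sign E t * removal_sign (?R E t) t'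
      * corr v (?R (?R E t) t'))"
    unfolding expand
    by (rule sum.reindex_bij_witness[where i = prod.swap and j = prod.swap])
      (auto simp: choices_def, metis+)
  also have "\<dots> = (\<Sum>(t', t)\<in>?T y x. (- 1) ^ CARD('k) *
      (removal_sign E t' * removal_sign (?R E t') t * corr v (?R (?R E t') t)))"
  proof (rule sum.cong[OF refl], safe)
    fix t' t
    assume t: "t' \<in> choices E y" "t \<in> choices (?R E t') x"
    have "?R (?R E t) t' = ?R (?R E t') t"
      by auto
    moreover have "removal_sign E t * removal_sign (?R E t) t'
        = (- 1) ^ CARD('k) * (removal_sign E t' * removal_sign (?R E t') t)"
      by (rule removal_sign_swap) (use t assms in \<open>auto simp: choices_def\<close>)
    ultimately show "removal_sign E t * removal_sign (?R E t) t' * corr v (?R (?R E t) t')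
        = (- 1) ^ CARD('k) * (removal_sign E t' * removal_sign (?R E t') t * corr v (?R (?R E t') t))"
      by (simp only: mult.assoc)
  qed
  also have "\<dots> = (- 1) ^ CARD('k) * corr (y # x # v) E"
    unfolding expand sum_distrib_left by (simp add: split_beta)
  finally show ?thesis .
qed

lemma corr_functional:
  fixes E :: "'k \<Rightarrow> int set"
  assumes "\<And>i. finite (E i)"
  shows "word_functional CARD('k) (\<lambda>w. corr w E)"
  unfolding word_functional_def
proof (intro conjI allI impI)
  fix u v and x y :: "nat \<times> int"
  show "corr (u @ x # y # v) E = (- 1) ^ CARD('k) * corr (u @ y # x # v) E"
    using assms
  proof (induction u arbitrary: E)
    case Nil
    then show ?case
      unfolding append_Nil by (rule corr_swap_head)
  next
    case (Cons z u)
    have "corr (u @ x # y # v) (\<lambda>i. E i - {t i})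
        = (- 1) ^ CARD('k) * corr (u @ y # x # v) (\<lambda>i. E i - {t i})" for t
      by (rule Cons.IH) (use Cons.prems in auto)
    then show ?case
      by (simp only: append_Cons corr.simps sum_distrib_left mult.left_commute)
  qed
next
  fix w :: "(nat \<times> int) list"
  assume "\<exists>(a, n)\<in>set w. CARD('k) < a"
  then obtain a n where a: "(a, n) \<in> set w" "CARD('k) < a"
    by auto
  show "corr w E = 0"
  proof (rule ccontr)
    assume "corr w E \<noteq> 0"
    then obtain t :: "'k \<Rightarrow> int" where "(a, n) = letter t"
      using a(1) by (rule corr_letters)
    with a(2) letter_le[OF fin, of t a n] show False
      by simp
  qed
qed

text \<open>The set \<open>S\<close> of a pairing records the factors whose smaller mode is removed first.\<close>

lemma corr_two_rows:
  fixes f g :: "'k \<Rightarrow> int"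
  assumes "\<And>i. g i < f i"
  shows "corr w (\<lambda>i. {f i, g i}) = pairing f g w"
proof (cases "length w = 2")
  case False
  \<comment> \<open>One arbitrary factor, \<open>undefined\<close>, suffices: its two modes force
    words of length two.\<close>
  then have "corr w (\<lambda>i. {f i, g i}) = 0"
    using corr_card[of w "\<lambda>i. {f i, g i}" undefined] assms by (force simp: order_less_imp_not_eq2)
  with False show ?thesis
    by (simp add: pairing_length)
next
  case True
  then obtain x y where w: "w = [x, y]"
    by (auto simp: length_Suc_conv numeral_2_eq_2)
  let ?E = "\<lambda>i. {f i, g i}"
  have single: "corr [y] (\<lambda>i. {h i}) = of_bool (letter h = y)" for h :: "'k \<Rightarrow> int"
  proof -
    have "choices (\<lambda>i. {h i}) y = (if letter h = y then {h} else {})"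
      by (auto simp: choices_def fun_eq_iff[symmetric])
    moreover have "{e \<in> {h i}. h i < e} = {}" for i
      by auto
    then have "removal_sign (\<lambda>i. {h i}) h = 1"
      unfolding removal_sign_def by (simp only: card.empty power_0 prod.neutral_const)
    ultimately show ?thesis
      by simp
  qed
  have rest: "corr [y] (\<lambda>i. ?E i - {mix S f g i}) = of_bool (letter (mix S g f) = y)" for S
  proof -
    have "(\<lambda>i. ?E i - {mix S f g i}) = (\<lambda>i. {mix S g f i})"
      using assms by (auto simp: mix_def fun_eq_iff order_less_imp_not_eq order_less_imp_not_eq2)
    then show ?thesis
      by (simp only: single)
  qed
  have sign: "removal_sign ?E (mix S f g) = (- 1) ^ card S" for S :: "'k set"
  proof -
    have "card {e \<in> ?E i. mix S f g i < e} = (if i \<in> S then 1 else 0)" for i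
    proof -
      have "{e \<in> ?E i. mix S f g i < e} = (if i \<in> S then {f i} else {})"
        using assms[of i] by (auto simp: mix_def)
      then show ?thesis by simp
    qed
    then have "removal_sign ?E (mix S f g) = (\<Prod>i\<in>UNIV. if i \<in> S then - 1 else 1)"
      unfolding removal_sign_def by (intro prod.cong) auto
    also have "\<dots> = (\<Prod>i\<in>S. - 1)"
      using prod.inter_restrict[OF fin, of "\<lambda>_. - 1 :: complex" S] by simp
    finally show ?thesis by simp
  qed
  have "corr w ?E = (\<Sum>S\<in>{S. letter (mix S f g) = x}. (- 1) ^ card S * of_bool (letter (mix S g f) = y))"
    unfolding w corr.simps(2)[of x]
  proof (rule sum.reindex_bij_witness[where i = "\<lambda>S. mix S f g" and j = "\<lambda>t. {i. t i = g i}"])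
    fix t
    assume t: "t \<in> choices ?E x"
    then have "t i = f i \<or> t i = g i" for i
      by (auto simp: choices_def)
    then have "mix {i. t i = g i} f g i = t i" for i
      unfolding mix_def mem_Collect_eq by metis
    then show mix: "mix {i. t i = g i} f g = t"
      by (rule ext)
    show "{i. t i = g i} \<in> {S. letter (mix S f g) = x}"
      using t by (simp add: mix) (simp add: choices_def)
    show "(- 1) ^ card {i. t i = g i} * of_bool (letter (mix {i. t i = g i} g f) = y)
        = removal_sign ?E t * corr [y] (\<lambda>i. ?E i - {t i})"
      using rest[of "{i. t i = g i}"] sign[of "{i. t i = g i}"] by (simp only: mix)
  next
    fix S
    assume "S \<in> {S. letter (mix S f g) = x}"
    then show "mix S f g \<in> choices ?E x"
      by (auto simp: choices_def mix_def)
    show "{i. mix S f g i = g i} = S"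
      using assms by (auto simp: mix_def order_less_imp_not_eq2)
  qed
  also have "\<dots> = pairing f g w"
    unfolding pairing_def w
    by (rule sum.mono_neutral_cong_left) (use fin in \<open>auto simp: Finite_Set.finite_set\<close>)
  finally show ?thesis .
qed

section \<open>Vanishing on the relations that define \<open>hker\<close>\<close>

text \<open>Reading \<open>u\<close> leaves two modes in every factor, so the functional becomes a
  combination of pairings; nonnegative modes put these at level 0, where \<open>hker\<close> reads
  the relations.\<close>

lemma corr_quad_rel:
  fixes E :: "'k \<Rightarrow> int set" and v :: "'k bk"
  assumes "2 \<le> CARD('k)" "y \<in> quad_rel" "v \<in> y 0"
    and "\<And>i. finite (E i)" "\<And>i. card (E i) = length u + 2" "\<And>i. E i \<subseteq> {0..}"
  shows "bk_sum (\<lambda>w. corr (u @ w) E) v = 0"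
  using assms(4-6)
proof (induction u arbitrary: E)
  case Nil
  have "\<exists>f g. E i = {f, g} \<and> g < f \<and> 0 \<le> g" for i
  proof -
    have "card (E i) = 2"
      using Nil.prems(2)[of i] by simp
    then obtain a b where "E i = {a, b}" "a \<noteq> b"
      unfolding card_2_iff by blast
    moreover have "0 \<le> a" "0 \<le> b"
      using Nil.prems(3)[of i] calculation by auto
    ultimately show ?thesis
      by (metis insert_commute linorder_neqE)
  qed
  then obtain f g where fg: "\<And>i. E i = {f i, g i}" "\<And>i. g i < f i" "\<And>i. 0 \<le> g i"
    by metis
  have "0 \<le> (\<Sum>i\<in>UNIV. min (f i div 2) (g i div 2))"
    using fg(2,3) by (intro sum_nonneg) (smt (verit) pos_imp_zdiv_nonneg_iff)
  then have "level_above f g 0"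
    by (simp add: level_above_def)
  moreover have "(\<lambda>w. corr w E) = pairing f g"
    using corr_two_rows[OF fg(2)] fg(1) by presburger
  ultimately show ?case
    using pairing_quad_rel[OF fin assms(1,2) _ assms(3)] by simp
next
  case (Cons x u)
  have "bk_sum (\<lambda>w. corr (u @ w) (\<lambda>i. E i - {t i})) v = 0" if "t \<in> choices E x" for t
    by (rule Cons.IH) (use Cons.prems that in \<open>auto simp: choices_def\<close>)
  then show ?case
    by (simp add: bk_sum_linear finite_choices Cons.prems)
qed

text \<open>\<open>R\<close> encodes the boundary condition: for \<open>i \<in> R\<close> a mode is
  at least 1, hence odd or with a positive power of z. For a letter \<open>(a, n)\<close> this gives
  \<open>r - a \<le> - n\<close> and \<open>0 \<le> - n\<close>, so the last letters that span
  \<open>nspace\<close> never occur.\<close>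

lemma corr_hker:
  fixes E :: "'k \<Rightarrow> int set"
  assumes "2 \<le> CARD('k)" "1 \<le> s" "card R = r"
    and fin_E: "\<And>i. finite (E i)" and card_E: "\<And>i. card (E i) = s" and E: "\<And>i. E i \<subseteq> {of_bool (i \<in> R)..}"
    and x: "(x :: 'k bk) \<in> hker r s"
  shows "bk_sum (\<lambda>w. corr w E) x = 0"
proof -
  note G = corr_functional[of E, OF fin_E]
  have bound: "n \<le> min (int a - int r) 0" if mem: "corr w E \<noteq> 0" "(a, n) \<in> set w" for w a n
  proof -
    obtain t where t: "\<And>i. t i \<in> E i" "(a, n) = letter t"
      using corr_letters[OF mem] by metis
    have ti: "of_bool (i \<in> R) \<le> t i" for i
      using subsetD[OF E t(1), of i] by simp
    have "of_bool (i \<in> R) - of_bool (odd (t i)) \<le> t i div 2" "0 \<le> t i div 2" for i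
      using ti[of i] by (cases "i \<in> R"; cases "odd (t i)"; force elim!: oddE)+
    then have "(\<Sum>i\<in>UNIV. of_bool (i \<in> R) - of_bool (odd (t i))) \<le> (\<Sum>i\<in>UNIV. t i div 2)"
      "0 \<le> (\<Sum>i\<in>UNIV. t i div 2)"
      by (auto intro!: sum_mono sum_nonneg)
    moreover have "(\<Sum>i\<in>UNIV. of_bool (i \<in> R)) = int r"
      using assms(3) by (simp add: sum_of_bool_eq fin)
    ultimately show ?thesis
      using t(2) card_odd[OF fin, of t, where 'b = int] by (simp add: sum_subtractf letter_def)
  qed
  have nonneg: "E i \<subseteq> {0..}" for i
    by (rule order_trans[OF E]) simp
  have nspace: "bk_sum (\<lambda>w. corr w E) (x * phi a n) = 0" if "min (int a - int r) 0 < n"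
    for x :: "'k bk" and a n
  proof (induction x rule: bk_induct)
    case (mono c w)
    have "monomial w * phi a n = (monomial (w @ [(a, n)]) :: 'k bk)"
      by (simp add: monomial_append monomial_Cons monomial_Nil)
    moreover have "corr (w @ [(a, n)]) E = 0"
    proof (rule ccontr)
      assume "corr (w @ [(a, n)]) E \<noteq> 0"
      then have "n \<le> min (int a - int r) 0"
        by (rule bound) simp
      with that show False
        by simp
    qed
    ultimately show ?case
      by (simp add: bscale_mult bk_sum_scale bk_sum_monomial G)
  qed (simp_all add: distrib_right bk_sum_zero bk_sum_add G)
  have ideal: "bk_sum (\<lambda>w. corr w E) q = 0" if "q \<in> bgr_ideal s' 0" for q :: "'k bk" and s'
  proof (rule bk_sum_ideal[OF G, of 0])
    fix u v a and m :: int
    assume "0 < m"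
    then show "corr (u @ (a, m) # v) E = 0"
      using bound[of "u @ (a, m) # v" a m] by auto
  qed (use that in \<open>simp add: bgr_ideal_def\<close>)
  have quad: "bk_sum (\<lambda>w. corr w E) z = 0"
    if mem: "2 \<le> s" "z \<in> bbar_mult s x y 0" "x \<in> bbar (s - 2)" "y \<in> quad_rel" for x y and z :: "'k bk"
  proof -
    obtain p v q where z: "z = p * v + q" "p \<in> x 0" "v \<in> y 0" "q \<in> bgr_ideal s 0"
      using mem(2) by (auto simp: bbar_mult_def elim!: set_plus_elim set_times_elim)
    obtain u where u: "u \<in> bgr (s - 2)" "x 0 = u +o bgr_ideal (s - 2) 0"
      using mem(3) unfolding bbar_def by blast
    with z(2) have "p \<in> bgr (s - 2)"
      by (auto simp: elt_set_plus_def bgr_ideal_def bgr_def intro: bk.span_add)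
    \<comment> \<open>\<open>p\<close> is a combination of monomials with \<open>s - 2\<close>
      letters, which leave exactly two of the \<open>s\<close> modes of each factor for
      \<open>v\<close>.\<close>
    then have "bk_sum (\<lambda>w. corr w E) (p * v) = 0"
      unfolding bgr_def
    proof (induction rule: bk.span_induct_alt)
      case base
      show ?case
        by (simp add: bk_sum_zero G)
    next
      case (step c m p)
      then obtain w where w: "m = monomial w" "length w = s - 2"
        by auto
      have "bk_sum (\<lambda>w. corr w E) (m * v) = 0"
        unfolding w bk_sum_prefix[OF G]
        by (rule corr_quad_rel[OF assms(1) mem(4) z(3)])
          (use fin_E card_E nonneg w(2) mem(1) in auto)
      with step.IH show ?case
        by (simp add: distrib_right bscale_mult bk_sum_add bk_sum_scale G)
    qed
    with ideal[OF z(4)] show ?thesis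
      by (simp add: z(1) bk_sum_add G)
  qed
  have "bk_sum (\<lambda>w. corr w E) z = 0" if "z \<in> nspace r s" for z :: "'k bk"
    using _ that unfolding nspace_def by (rule bk_sum_span[OF G]) (auto intro: nspace)
  then show ?thesis
    by (intro bk_sum_span[OF G _ x[unfolded hker_def]]) (use quad in \<open>auto split: if_splits\<close>)
qed

subsection \<open>Triangularity\<close>

text \<open>The row \<open>t\<close> holds the largest mode of each factor, so its removal passes
  none, and any other choice has a smaller sum of entries.\<close>

lemma corr_entries_Cons:
  fixes t :: "'k \<Rightarrow> int"
  assumes "\<forall>u\<in>set ts. \<forall>i. u i < t i"
  shows "removal_sign (entries (t # ts)) t = 1" "(\<lambda>i. entries (t # ts) i - {t i}) = entries ts"
    and "t' \<in> choices (entries (t # ts)) x \<Longrightarrow> t' = t \<or> key x < key (letter t)"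
proof -
  have le: "e \<le> t i" if "e \<in> entries (t # ts) i" for e i
    using that assms by (auto simp: entries_def less_imp_le)
  have "{e \<in> entries (t # ts) i. t i < e} = {}" for i
    by (auto dest!: le)
  then show "removal_sign (entries (t # ts)) t = 1"
    unfolding removal_sign_def by (simp only: card.empty power_0 prod.neutral_const)
  have "entries (t # ts) i = insert (t i) (entries ts i)" "t i \<notin> entries ts i" for i
    using assms by (auto simp: entries_def dest!: bspec dest: spec[of _ i])
  then show "(\<lambda>i. entries (t # ts) i - {t i}) = entries ts"
    by (intro ext) (metis Diff_insert_absorb)
  assume "t' \<in> choices (entries (t # ts)) x"
  then have x: "x = letter t'" and le: "t' i \<le> t i" for i
    by (auto simp: choices_def intro: le)
  show "t' = t \<or> key x < key (letter t)"
  proof (cases "t' = t")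
    case False
    then have "\<exists>i. t' i < t i"
      using le by (metis ext order_le_less)
    then show ?thesis
      unfolding x key_letter using le by (intro disjI2 sum_strict_mono_ex1[OF fin]) auto
  qed simp
qed

text \<open>At each letter only the top row can be removed, since any other choice has a letter of
  smaller key.\<close>

lemma corr_entries_self:
  fixes ts :: "('k \<Rightarrow> int) list"
  assumes "sorted_wrt (\<lambda>t u. \<forall>i. u i < t i) ts"
  shows "corr (map letter ts) (entries ts) = 1"
  using assms
proof (induction ts)
  case (Cons t ts)
  then have t: "\<forall>u\<in>set ts. \<forall>i. u i < t i"
    by auto
  have "choices (entries (t # ts)) (letter t) = {t}"
    using corr_entries_Cons(3)[OF t, of _ "letter t"] by (auto simp: choices_def entries_def)
  with Cons corr_entries_Cons[OF t] show ?case
    by simp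
qed (simp add: entries_def)

text \<open>Word and tower agree as long as top rows are removed; the first other choice strictly
  lowers the key.\<close>

lemma corr_entries_lex:
  fixes ts :: "('k \<Rightarrow> int) list"
  assumes "sorted_wrt (\<lambda>t u. \<forall>i. u i < t i) ts" "corr w (entries ts) \<noteq> 0"
  shows "w = map letter ts \<or> (map key w, map key (map letter ts)) \<in> lexord {(p, q). p < q}"
  using assms
proof (induction ts arbitrary: w)
  case Nil
  show ?case
  proof (cases w)
    case (Cons x v)
    with Nil show ?thesis
      by (simp add: entries_def choices_def)
  qed simp
next
  case (Cons t ts)
  then have t: "\<forall>u\<in>set ts. \<forall>i. u i < t i"
    by auto
  obtain x v where w: "w = x # v"
    using Cons.prems(2) by (cases w) (auto simp: entries_def)
  obtain t' where t': "t' \<in> choices (entries (t # ts)) x"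
    "corr v (\<lambda>i. entries (t # ts) i - {t' i}) \<noteq> 0"
    using Cons.prems(2) unfolding w by (rule corr_Cons_nonzero)
  from corr_entries_Cons(3)[OF t t'(1)] show ?case
  proof
    assume "t' = t"
    with t' have "x = letter t" "corr v (entries ts) \<noteq> 0"
      using corr_entries_Cons(2)[OF t] by (auto simp: choices_def)
    with Cons show ?thesis
      by (auto simp: w)
  next
    assume "key x < key (letter t)"
    then show ?thesis
      by (simp add: w)
  qed
qed

text \<open>Factor \<open>i\<close> has to rise by at least one power of \<open>z\<close>, unless its entry becomes odd and was even.
  Choosing the odd positions of the new row as disjoint as possible from those of the old row makes
  the total minimal rise equal to the bound in the definition of normal words.\<close>

lemma exists_row_above:
  fixes t :: "'k \<Rightarrow> int"
  assumes "letter t = (a', n')" "a \<le> CARD('k)" "int CARD('k) \<le> min (int a) (int CARD('k) - int a') - n + n'"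
    and "1 \<le> CARD('k)"
  obtains t' where "letter t' = (a, n)" "\<And>i. t i < t' i"
proof -
  let ?k = "CARD('k)"
  define A' where "A' = {i. odd (t i)}"
  have fins: "finite S" for S :: "'k set"
    using finite_subset[OF subset_UNIV fin] .
  have a': "card A' = a'" and n': "n' = - (\<Sum>i\<in>UNIV. t i div 2)"
    using assms(1) by (auto simp: letter_def A'_def)
  have compl: "card (- A') + a' = ?k"
    using card_Un_disjoint[of "- A'" A'] fins a' by (simp add: Un_commute)
  have "\<exists>A. card A = a \<and> int (card (A - A')) = min (int a) (int ?k - int a')"
  proof (cases "a \<le> card (- A')")
    case True
    then obtain A where "A \<subseteq> - A'" "card A = a"
      using obtain_subset_with_card_n by metis
    moreover from this have "A - A' = A"
      by auto
    ultimately show ?thesis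
      using True compl by (intro exI[of _ A]) auto
  next
    case False
    have "a - card (- A') \<le> card A'"
      using assms(2) a' compl by simp
    then obtain B where B: "B \<subseteq> A'" "card B = a - card (- A')"
      using obtain_subset_with_card_n by metis
    have "card (- A' \<union> B) = a"
      using B False by (subst card_Un_disjoint) (auto simp: fins)
    moreover have "- A' \<union> B - A' = - A'"
      using B by auto
    ultimately show ?thesis
      using False compl by (intro exI[of _ "- A' \<union> B"]) auto
  qed
  then obtain A where A: "card A = a" "int (card (A - A')) = min (int a) (int ?k - int a')"
    by blast
  \<comment> \<open>The slack \<open>m\<close> of the inequality is given to one arbitrary factor
    \<open>p\<close>.\<close>
  define p :: 'k where "p = undefined"
  define m where "m = min (int a) (int ?k - int a') - n + n' - int ?k"
  define t' where "t' i = 2 * (t i div 2 + of_bool (i \<notin> A - A') + (if i = p then m else 0)) + of_bool (i \<in> A)" for i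
  have m: "0 \<le> m"
    using assms(3) by (simp add: m_def)
  have odd: "odd (t' i) \<longleftrightarrow> i \<in> A" and div: "t' i div 2 = t i div 2 + of_bool (i \<notin> A - A') + (if i = p then m else 0)" for i
    by (auto simp: t'_def)
  have "(\<Sum>i\<in>UNIV. of_bool (i \<notin> A - A')) = int (card (- (A - A')))"
    unfolding Compl_eq by (simp add: sum_of_bool_eq fin)
  moreover have "card (- (A - A')) + card (A - A') = ?k"
    using card_Un_disjoint[of "- (A - A')" "A - A'"] fins by (simp add: Un_commute del: Compl_Diff_eq Diff_Compl)
  ultimately have "(\<Sum>i\<in>UNIV. t' i div 2) = - n"
    using A(2) by (simp add: div sum.distrib fin m_def n')
  then have "letter t' = (a, n)"
    using A(1) by (simp add: letter_def odd)
  moreover have "t i < t' i" for i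
  proof -
    have "t i = 2 * (t i div 2) + of_bool (i \<in> A')"
      by (auto simp: A'_def elim!: evenE oddE)
    then show ?thesis
      using m by (auto simp: t'_def)
  qed
  ultimately show ?thesis
    using that by blast
qed

section \<open>Towers of rows over normal words\<close>

lemma normal_words_tower:
  assumes "1 \<le> CARD('k)" "r \<le> CARD('k)" "1 \<le> s" "w \<in> normal_words CARD('k) r s" "card R = r"
  obtains ts :: "('k \<Rightarrow> int) list" where "map letter ts = w" "sorted_wrt (\<lambda>t u. \<forall>i. u i < t i) ts"
    "\<And>t i. t \<in> set ts \<Longrightarrow> of_bool (i \<in> R) \<le> t i"
proof -
  let ?k = "CARD('k)"
  \<comment> \<open>An extra bottom row turns the condition on the last letter into the condition on neighbours.\<close>
  let ?b = "\<lambda>i. of_bool (i \<in> R) - 1 :: int"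
  \<comment> \<open>Against this letter the neighbour condition reads
    \<open>n \<le> min a r - r\<close>, which is the condition on the last letter.\<close>
  have b: "letter ?b = (?k - r, int (?k - r))"
  proof -
    have "card (- R) = ?k - r"
      using assms(5) fin card_Diff_subset[of R UNIV] by (simp add: Compl_eq_Diff_UNIV rev_finite_subset)
    moreover have "{i. odd (?b i)} = - R" "\<And>i. ?b i div 2 = - of_bool (i \<notin> R)"
      by auto
    moreover have "(\<Sum>i\<in>UNIV. of_bool (i \<notin> R)) = int (card (- R))"
      unfolding Compl_eq by (simp add: sum_of_bool_eq fin)
    ultimately show ?thesis
      by (simp only: letter_def sum_negf)  simp
  qed
  let ?ok = "\<lambda>x y. int ?k \<le> min (int (fst x)) (int ?k - int (fst y)) - snd x + snd y"
  have tower: "\<exists>ts. map letter ts = v \<and> sorted_wrt (\<lambda>t u. \<forall>i. u i < t i) (ts @ [?b])"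
    if "successively ?ok (v @ [letter ?b])" "\<forall>(a, n)\<in>set v. a \<le> ?k" for v
    using that
  proof (induction v)
    case (Cons x v)
    then obtain ts where ts: "map letter ts = v" "sorted_wrt (\<lambda>t u. \<forall>i. u i < t i) (ts @ [?b])"
      by (auto simp: successively_Cons)
    define u where "u = hd (ts @ [?b])"
    have "v @ [letter ?b] = map letter (ts @ [?b])"
      using ts by simp
    then have "?ok x (letter u)"
      using Cons.prems(1) by (simp add: successively_Cons u_def hd_map del: map_append)
    then obtain t where t: "letter t = x" "\<And>i. u i < t i"
      using exists_row_above[of u "fst (letter u)" "snd (letter u)" "fst x" "snd x"] Cons.prems(2) assms(1)
      by (cases x) auto
    have "\<forall>i. u' i < t i" if "u' \<in> set (ts @ [?b])" for u'
    proof
      fix i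
      have "u' i \<le> u i"
        using ts(2) that unfolding u_def by (cases ts) (auto simp: less_imp_le)
      with t(2)[of i] show "u' i < t i"
        by linarith
    qed
    with ts t show ?case
      by (intro exI[of _ "t # ts"]) auto
  qed (auto intro: exI[of _ "[]"])
  have w: "length w = s" "\<forall>(a, n)\<in>set w. a \<le> ?k" "w \<noteq> []"
    "\<And>j. Suc j < s \<Longrightarrow> ?ok (w ! j) (w ! Suc j)" "snd (last w) \<le> min (int (fst (last w)) - int r) 0"
    using assms(3,4) by (auto simp: normal_words_def split_beta Let_def)
  have "successively ?ok w"
    using w(1,4) by (simp add: successively_conv_nth)
  moreover have "?ok (last w) (letter ?b)"
    using w(5) assms(2) by (simp add: b of_nat_diff) linarith
  ultimately have "successively ?ok (w @ [letter ?b])"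
    using w(3) by (simp add: successively_append_iff)
  from tower[OF this w(2)] obtain ts where ts: "map letter ts = w"
    "sorted_wrt (\<lambda>t u. \<forall>i. u i < t i) (ts @ [?b])"
    by blast
  \<comment> \<open>Lying above the bottom row amounts to the lower bound on modes that
    \<open>corr_hker\<close> demands.\<close>
  have "of_bool (i \<in> R) \<le> t i" if "t \<in> set ts" for t i
  proof -
    have "?b i < t i"
      using ts(2) that by (simp add: sorted_wrt_append)
    then show ?thesis
      by linarith
  qed
  with ts show ?thesis
    by (intro that[of ts]) (simp_all add: sorted_wrt_append)
qed

lemma tower_functional:
  fixes w :: "(nat \<times> int) list"
  assumes "2 \<le> CARD('k)" "r \<le> CARD('k)" "1 \<le> s" "w \<in> normal_words CARD('k) r s"
  obtains G where "word_functional CARD('k) G" "\<And>x :: 'k bk. x \<in> hker r s \<Longrightarrow> bk_sum G x = 0"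
    "G w = 1" "\<And>w'. G w' \<noteq> 0 \<Longrightarrow> w' = w \<or> (map key w', map key w) \<in> lexord {(p, q). p < q}"
proof -
  obtain R :: "'k set" where R: "card R = r"
    using obtain_subset_with_card_n[OF assms(2)] by metis
  obtain ts :: "('k \<Rightarrow> int) list" where ts: "map letter ts = w"
    "sorted_wrt (\<lambda>t u. \<forall>i. u i < t i) ts" "\<And>t i. t \<in> set ts \<Longrightarrow> of_bool (i \<in> R) \<le> t i"
    using normal_words_tower[of r s w R] assms R by auto
  have card: "card (entries ts i) = s" for i
  proof -
    have "distinct (map (\<lambda>t. t i) ts)"
      using ts(2) by (induction ts) (auto simp: image_iff, metis less_irrefl)
    moreover have "length ts = s"
      using ts(1) assms(4) by (auto simp: normal_words_def)
    ultimately show ?thesis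
      using distinct_card[of "map (\<lambda>t. t i) ts"] by (simp add: entries_def)
  qed
  show ?thesis
  proof (rule that)
    show "word_functional CARD('k) (\<lambda>w. corr w (entries ts))"
      by (rule corr_functional) (simp add: entries_def)
    show "bk_sum (\<lambda>w. corr w (entries ts)) x = 0" if "x \<in> hker r s" for x :: "'k bk"
      by (rule corr_hker[OF assms(1,3) R _ card _ that])
        (simp_all add: entries_def image_subset_iff ts(3))
    show "corr w (entries ts) = 1"
      using corr_entries_self[OF ts(2)] ts(1) by simp
    show "w' = w \<or> (map key w', map key w) \<in> lexord {(p, q). p < q}" if "corr w' (entries ts) \<noteq> 0" for w'
      using corr_entries_lex[OF ts(2) that] ts(1) by simp
  qed
qed

end

section \<open>Linear independence by way of a minimal word\<close>

theorem proposition12: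
  fixes k r s :: nat
  assumes "CARD('k) = k" and "2 \<le> k" and "r \<le> k" and "1 \<le> s"
  shows "hindependent r s (\<lambda>w. hvec r s (monomial w :: 'k bk)) (normal_words k r s)"
  unfolding hindependent_def
proof (intro conjI allI impI)
  \<comment> \<open>An infinite type would have \<open>CARD('k) = 0\<close>.\<close>
  have fin: "finite (UNIV :: 'k set)"
    using assms(1,2) card.infinite by fastforce
  show "(\<lambda>w. hvec r s (monomial w :: 'k bk)) ` normal_words k r s \<subseteq> hspace r s"
    using assms(1) by (auto simp: hspace_def normal_words_def bgr_def intro!: imageI bk.span_base)
  fix F and c :: "(nat \<times> int) list \<Rightarrow> complex"
  assume F: "finite F \<and> F \<subseteq> normal_words k r s
    \<and> (\<Sum>w\<in>F. hscale r s (c w) (hvec r s (monomial w :: 'k bk))) = hker r s"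
  \<comment> \<open>Each scaled coset contains its scaled representative, so the sum of cosets
    contains the sum of representatives.\<close>
  have mem: "bscale c x \<in> hscale r s c (hvec r s x)" for c and x :: "'k bk"
  proof -
    have "0 \<in> (hker r s :: 'k bk set)"
      by (simp add: hker_def bk.span_zero)
    then have "x \<in> hvec r s x"
      by (auto simp: hvec_def elt_set_plus_def)
    with \<open>0 \<in> hker r s\<close> show ?thesis
      unfolding hscale_def by (metis add.right_neutral imageI set_plus_intro)
  qed
  have "(\<Sum>w\<in>F. bscale (c w) (monomial w)) \<in> (\<Sum>w\<in>F. hscale r s (c w) (hvec r s (monomial w :: 'k bk)))"
    using F mem by (subst set_sum_alt) auto
  with F have rel: "(\<Sum>w\<in>F. bscale (c w) (monomial w)) \<in> (hker r s :: 'k bk set)"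
    by simp
  let ?less = "\<lambda>v w. (map key v, map key w) \<in> lexord {(p :: int, q). p < q}"
  show "\<forall>w\<in>F. c w = 0"
  proof (rule ccontr)
    assume "\<not> (\<forall>w\<in>F. c w = 0)"
    then have ne: "{w \<in> F. c w \<noteq> 0} \<noteq> {}"
      by auto
    have "asym {(p :: int, q). p < q}" "trans {(p :: int, q). p < q}"
      by (auto simp: asym_iff trans_def)
    then have "asymp_on {w \<in> F. c w \<noteq> 0} ?less" "transp_on {w \<in> F. c w \<noteq> 0} ?less"
      by (auto intro!: asymp_onI transp_onI dest: lexord_asymmetric lexord_trans)
    \<comment> \<open>Different words can share their keys, so the order is only partial; at a
      minimal word with nonzero coefficient, its functional kills all other terms of the
      relation.\<close>
    then obtain w where w: "w \<in> F" "c w \<noteq> 0"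
      and least: "\<And>v. v \<in> F \<Longrightarrow> c v \<noteq> 0 \<Longrightarrow> v \<noteq> w \<Longrightarrow> \<not> ?less v w"
      using Finite_Set.bex_min_element[of "{w \<in> F. c w \<noteq> 0}" ?less] F ne by auto
    obtain G where G: "word_functional CARD('k) G" "\<And>x :: 'k bk. x \<in> hker r s \<Longrightarrow> bk_sum G x = 0"
      "G w = 1" "\<And>v. G v \<noteq> 0 \<Longrightarrow> v = w \<or> ?less v w"
      using tower_functional[OF fin, of r s w] assms F w(1) by blast
    have "0 = bk_sum G (\<Sum>w\<in>F. bscale (c w) (monomial w) :: 'k bk)"
      using G(2)[OF rel] by simp
    also have "\<dots> = (\<Sum>v\<in>F. c v * G v)"
      by (simp add: bk_sum_sum bk_sum_scale bk_sum_monomial G(1))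
    also have "\<dots> = (\<Sum>v\<in>F. if v = w then c w else 0)"
      using G(3,4) least by (intro sum.cong) auto
    also have "\<dots> = c w"
      using F w by simp
    finally show False
      using w by simp
  qed
qed

end
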